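(* Consider the distributed locally equality-constrained problem $\mathcal P_{\mathrm d}$ of the context, and assume: (1) the graph $\mathcal G$ is undirected and connected; (2) each $f_i:\mathbb R^d\to\mathbb R$ and each $\mathbf h_i^{\mathrm d}:\mathbb R^d\to\mathbb R^{r_i}$ is twice continuously differentiable, and $\nabla^2 f_i$ and the Jacobian $\mathbf J_i^{\mathrm d}=\partial\mathbf h_i^{\mathrm d}/\partial\mathbf x_i$ are locally Lipschitz continuous; (3) there exist $\mathbf s_{\mathrm d}^{\ast}\in\Omega_{\mathrm d}$, an open neighborhood $\mathcal U_{\mathrm d}\subset\mathbb R^d$ of $\mathbf s_{\mathrm d}^{\ast}$ and $\rho_{\mathrm d}>0$ such that $\mathbf s_{\mathrm d}^{\ast}$ is a local minimizer of $F$ on $\Omega_{\mathrm d}\cap\mathcal U_{\mathrm d}$ and $F(\mathbf s)\ge F(\mathbf s_{\mathrm d}^{\ast})+\frac{\rho_{\mathrm d}}{2}\|\mathbf s-\mathbf s_{\mathrm d}^{\ast}\|^2$ for all $\mathbf s\in\Omega_{\mathrm d}\cap\mathcal U_{\mathrm d}$; (4) for every $\mathbf x=\operatorname{col}(\mathbf x_1,\ldots,\mathbf x_N)\in\mathcal X_{\mathrm d}\cap(\mathbf 1_N\otimes\mathcal U_{\mathrm d})$, $\operatorname{rank}\operatorname{col}(\mathbf J_1^{\mathrm d}(\mathbf x_1),\ldots,\mathbf J_N^{\mathrm d}(\mathbf x_N))=r$. Let $\mathbf x_{\mathrm d}^{\ast}:=\mathbf 1_N\otimes\mathbf s_{\mathrm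 d}^{\ast}$, let $\alpha_{\mathrm{SP}}\in(0,\min\{\rho_{\mathrm d}/N,\alpha_G\})$, let $\tau^\ast>0$ be a threshold for $\alpha_{\mathrm{SP}}$ for the continuous-time SP realization (as defined in the context), and fix any $\tau\in(0,\tau^\ast)$. Then, for any $\alpha_{\mathrm E}\in(0,\alpha_{\mathrm{SP}})$, there exists $T_{\mathrm d}^\ast>0$ such that, for every $T\in(0,T_{\mathrm d}^\ast)$, the algorithm FS-NDE $$\begin{aligned}\mathbf v^k&=K_{pc}\mathbf L\mathbf x^k+\mathbf z_c^k,\qquad \bm\mu^k=K_{ph}\mathbf h^{\mathrm d}(\mathbf x^k)+\mathbf z_h^k,\\ \mathbf x^{k+1}&=\mathbf x^k-T\big(\nabla f(\mathbf x^k)+\mathbf v^k+\tilde{\mathbf J}^{\mathrm d}(\mathbf x^k)^\top\bm\mu^k\big),\\ \mathbf z_c^{k+1}&=\mathbf z_c^k-TK_{pc}\mathbf G_g(\mathbf L\mathbf x^k),\qquad \mathbf z_h^{k+1}=\mathbf z_h^k-TK_{ph}\mathbf G_h(\mathbf h^{\mathrm d}(\mathbf x^k)),\end{aligned}$$ with $\mathbf z^k=\operatorname{col}(\mathbf z_c^k,\mathbf z_h^k)$ and $\mathbf z_c^0\in\operatorname{Im}\mathbf L$, admits a locally unique equilibrium $(\mathbf x_{\mathrm d}^{\ast},\mathbf z^\ast)$, which is locally exponentially stable. Specifically, there exist constants $C_{\mathrm E}>0$ and $\delta_{\mathrm E}>0$ such that, if $\|\mathbf x^0-\mathbf x_{\mathrm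 d}^{\ast}\|+\|\mathbf z^0-\mathbf z^\ast\|<\delta_{\mathrm E}$, then for all $k=0,1,2,\ldots$ $$\|\mathbf x^k-\mathbf x_{\mathrm d}^{\ast}\|+\|\mathbf z^k-\mathbf z^\ast\|+\|\mathbf L\mathbf x^k\|+\|\mathbf h^{\mathrm d}(\mathbf x^k)\|\le C_{\mathrm E}e^{-\alpha_{\mathrm E}kT}\big(\|\mathbf x^0-\mathbf x_{\mathrm d}^{\ast}\|+\|\mathbf z^0-\mathbf z^\ast\|\big).$$
   Context: Network: agents $\mathcal V=\{1,\ldots,N\}$ communicate over an undirected weighted graph $\mathcal G$ with symmetric adjacency matrix $[a_{ij}]$, $a_{ij}>0$ if $i,j$ can exchange information and $a_{ij}=0$ otherwise. The Laplacian $\mathbf L_{\mathcal G}$ has entries $[\mathbf L_{\mathcal G}]_{ij}=-a_{ij}$ ($i\ne j$) and $[\mathbf L_{\mathcal G}]_{ii}=\sum_j a_{ij}$. Put $\mathbf L:=\mathbf L_{\mathcal G}\otimes\mathbf I_d$. $\operatorname{col}$ denotes vertical concatenation, $\operatorname{blkdiag}$ the block-diagonal matrix, $\mathbf 1_N$ the all-ones vector, and $\mathbf 1_N\otimes\mathcal U:=\{\mathbf 1_N\otimes\mathbf s:\mathbf s\in\mathcal U\}$. Norms are Euclidean. Problem $\mathcal P_{\mathrm d}$: minimize $\sum_{i=1}^N f_i(\mathbf x_i)$ over $\mathbf x_1,\ldots,\mathbf x_N\in\mathbb R^d$ subject to $\mathbf x_i=\mathbf x_j$ for all $i,j$ and $\mathbf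 h_i^{\mathrm d}(\mathbf x_i)=\mathbf 0$ for all $i$, where $f_i:\mathbb R^d\to\mathbb R$, $\mathbf h_i^{\mathrm d}:\mathbb R^d\to\mathbb R^{r_i}$. Put $r:=\sum_i r_i$, $F(\mathbf s):=\sum_i f_i(\mathbf s)$, $\Omega_{\mathrm d}:=\{\mathbf s\in\mathbb R^d:\mathbf h_i^{\mathrm d}(\mathbf s)=\mathbf 0,\ i=1,\ldots,N\}$, $\mathcal X_{\mathrm d}:=\{\mathbf 1_N\otimes\mathbf s:\mathbf s\in\Omega_{\mathrm d}\}$. For $\mathbf x=\operatorname{col}(\mathbf x_1,\ldots,\mathbf x_N)\in\mathbb R^{Nd}$: $f(\mathbf x):=\sum_i f_i(\mathbf x_i)$, $\mathbf h^{\mathrm d}(\mathbf x):=\operatorname{col}(\mathbf h_1^{\mathrm d}(\mathbf x_1),\ldots,\mathbf h_N^{\mathrm d}(\mathbf x_N))$, $\tilde{\mathbf J}^{\mathrm d}(\mathbf x):=\operatorname{blkdiag}(\mathbf J_1^{\mathrm d}(\mathbf x_1),\ldots,\mathbf J_N^{\mathrm d}(\mathbf x_N))$. Assigned output vector field: $\mathbf G_{\mathrm d}:\operatorname{Im}\mathbf L\times\mathbb R^r\to\operatorname{Im}\mathbf L\times\mathbb R^r$ is a fixed continuously differentiable map with $\mathbf G_{\mathrm d}(\mathbf 0)=\mathbf 0$ such that the origin of $\dot{\mathbf y}=\mathbf G_{\mathrm d}(\mathbf y)$ is globally exponentially stable with convergence rate $\alpha_G>0$ (i.e. $\|\mathbf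 y(t)\|\le c\,e^{-\alpha_G t}\|\mathbf y(0)\|$ for some constant $c$ and all solutions). It is block-separable: $\mathbf G_{\mathrm d}(\operatorname{col}(\mathbf y_g,\mathbf y_h))=\operatorname{col}(\mathbf G_g(\mathbf y_g),\mathbf G_h(\mathbf y_h))$ with $\mathbf G_g(\mathbf y_g)=\operatorname{col}(\mathbf G_{g,1}(\mathbf y_{g,1}),\ldots,\mathbf G_{g,N}(\mathbf y_{g,N}))$ and $\mathbf G_h(\mathbf y_h)=\operatorname{col}(\mathbf G_{h,1}(\mathbf y_{h,1}),\ldots,\mathbf G_{h,N}(\mathbf y_{h,N}))$. Gains: $K_{0c},K_{0h}>0$ are fixed constants, $\tau>0$ is the singular-perturbation parameter, $K_{pc}:=K_{0c}/\tau$, $K_{ph}:=K_{0h}/\tau$; $T>0$ is the sampling period. Continuous-time SP realization: $\dot{\mathbf x}=-\nabla f(\mathbf x)-\mathbf v-\tilde{\mathbf J}^{\mathrm d}(\mathbf x)^{\top}\bm\mu$, $\mathbf v=K_{pc}\mathbf L\mathbf x+\mathbf z_c$, $\bm\mu=K_{ph}\mathbf h^{\mathrm d}(\mathbf x)+\mathbf z_h$, $\dot{\mathbf z}_c=-K_{pc}\mathbf G_g(\mathbf L\mathbf x)$, $\dot{\mathbf z}_h=-K_{ph}\mathbf G_h(\mathbf h^{\mathrm d}(\mathbf x))$, $\mathbf z=\operatorname{col}(\mathbf z_c,\mathbf z_h)$, $\mathbf z_c(0)\in\operatorname{Im}\mathbf L$. Threshold: $\tau^\ast>0$ is a threshold for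 $\alpha_{\mathrm{SP}}$ if for every $\tau\in(0,\tau^\ast)$ this realization has a locally unique equilibrium $(\mathbf x_{\mathrm d}^{\ast},\mathbf z^\ast)$ and there are $C_{\mathrm{SP}},\delta_{\mathrm{SP}}>0$ such that $\|\mathbf x(0)-\mathbf x_{\mathrm d}^{\ast}\|+\|\mathbf z(0)-\mathbf z^\ast\|<\delta_{\mathrm{SP}}$ implies $\|\mathbf x(t)-\mathbf x_{\mathrm d}^{\ast}\|+\|\mathbf z(t)-\mathbf z^\ast\|+\|\mathbf L\mathbf x(t)\|+\|\mathbf h^{\mathrm d}(\mathbf x(t))\|\le C_{\mathrm{SP}}e^{-\alpha_{\mathrm{SP}}t}(\|\mathbf x(0)-\mathbf x_{\mathrm d}^{\ast}\|+\|\mathbf z(0)-\mathbf z^\ast\|)$ for all $t\ge0$. (Under hypotheses (1)–(4) such a threshold exists for every $\alpha_{\mathrm{SP}}\in(0,\min\{\rho_{\mathrm d}/N,\alpha_G\})$.) The admissible state space, for both the continuous and discrete dynamics, is $\{(\mathbf x,\mathbf z_c,\mathbf z_h):\mathbf z_c\in\operatorname{Im}\mathbf L\}$, which is invariant; "locally unique equilibrium" means the only equilibrium (fixed point) in some neighborhood of it in this space. *)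

theory Defs
  imports "HOL-Analysis.Analysis"
begin

text \<open>
  Encoding.  Agents are the elements of a finite type \<open>'n\<close>, so \<open>N = CARD('n)\<close>, and a stacked vector
  \<open>col(x\<^sub>1, \<dots>, x\<^sub>N)\<close> with blocks in \<open>\<real>\<^sup>d\<close> has type \<open>real^'d^'n\<close>, whose norm is the Euclidean norm of
  the concatenation.  Likewise the norm of a pair is the Euclidean norm of the concatenated
  vector.

  The dimensions \<open>r\<^sub>i\<close> depend on the agent.  The space \<open>\<real>\<^sup>r\<^sup>i\<close> is the coordinate subspace of \<open>real^'m\<close>
  of vectors supported on an index set \<open>idx i :: 'm set\<close>, so \<open>r\<^sub>i = card (idx i)\<close> and \<open>r\<^sub>i = 0\<close> is
  allowed.  Every family \<open>(r\<^sub>i)\<close> arises, because \<open>'m\<close> is arbitrary.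
\<close>

subsection \<open>Smoothness\<close>

definition gradient :: "('a::real_inner \<Rightarrow> real) \<Rightarrow> 'a \<Rightarrow> 'a"
  where "gradient f x = (THE D. GDERIV f x :> D)"

text \<open>The set \<open>S\<close> is \<open>UNIV\<close> or a linear subspace.  On a proper subspace the derivative is relevant
  only in tangential directions, and its extension \<open>g'\<close> to the ambient space is arbitrary.\<close>

definition C1_on :: "'a::real_normed_vector set \<Rightarrow> ('a \<Rightarrow> 'b::real_normed_vector) \<Rightarrow> bool"
  where "C1_on S g \<longleftrightarrow>
    (\<exists>g' :: 'a \<Rightarrow> 'a \<Rightarrow>\<^sub>L 'b.
       (\<forall>x\<in>S. (g has_derivative blinfun_apply (g' x)) (at x within S)) \<and> continuous_on S g')"

definition C2 :: "('a::real_normed_vector \<Rightarrow> 'b::real_normed_vector) \<Rightarrow> bool"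
  where "C2 g \<longleftrightarrow>
    (\<exists>g' :: 'a \<Rightarrow> 'a \<Rightarrow>\<^sub>L 'b.
       (\<forall>x. (g has_derivative blinfun_apply (g' x)) (at x)) \<and> C1_on UNIV g')"

text \<open>The library notion is for time-dependent maps; here the time plays no role.\<close>

definition locally_Lipschitz :: "('a::metric_space \<Rightarrow> 'b::metric_space) \<Rightarrow> bool"
  where "locally_Lipschitz g \<longleftrightarrow> local_lipschitz {0::real} UNIV (\<lambda>_. g)"

subsection \<open>The network\<close>

definition undirected_graph :: "real^'n^'n \<Rightarrow> bool"
  where "undirected_graph A \<longleftrightarrow>
    (\<forall>i j. A $ i $ j \<ge> 0 \<and> A $ i $ j = A $ j $ i) \<and> (\<forall>i. A $ i $ i = 0)"

definition connected_graph :: "real^'n^'n \<Rightarrow> bool"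
  where "connected_graph A \<longleftrightarrow> (\<forall>i j. (\<lambda>u v. A $ u $ v > 0)\<^sup>*\<^sup>* i j)"

definition laplacian :: "real^'n^'n \<Rightarrow> real^'n^'n"
  where "laplacian A = (\<chi> i j. if i = j then (\<Sum>l\<in>UNIV. A $ i $ l) else - A $ i $ j)"

text \<open>The action of the Kronecker product \<open>M \<otimes> I\<^sub>d\<close> on stacked vectors.\<close>

definition kron_I :: "real^'n^'n \<Rightarrow> real^'d^'n \<Rightarrow> real^'d^'n"
  where "kron_I M x = (\<chi> i. \<Sum>j\<in>UNIV. M $ i $ j *\<^sub>R x $ j)"

abbreviation lap :: "real^'n^'n \<Rightarrow> real^'d^'n \<Rightarrow> real^'d^'n"
  where "lap A \<equiv> kron_I (laplacian A)"

text \<open>The vector \<open>1\<^sub>N \<otimes> s\<close>.\<close>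

definition ones_kron :: "real^'d \<Rightarrow> real^'d^'n"
  where "ones_kron s = (\<chi> i. s)"

definition stack :: "('n \<Rightarrow> real^'a \<Rightarrow> real^'b) \<Rightarrow> real^'a^'n \<Rightarrow> real^'b^'n"
  where "stack g x = (\<chi> i. g i (x $ i))"

subsection \<open>The constrained problem\<close>

definition block_space :: "'m set \<Rightarrow> (real^'m) set"
  where "block_space I = {y. \<forall>k. k \<notin> I \<longrightarrow> y $ k = 0}"

definition stacked_space :: "('n \<Rightarrow> 'm set) \<Rightarrow> (real^'m^'n) set"
  where "stacked_space idx = {y. \<forall>i. y $ i \<in> block_space (idx i)}"

definition total_dim :: "('n::finite \<Rightarrow> 'm set) \<Rightarrow> nat"
  where "total_dim idx = (\<Sum>i\<in>UNIV. card (idx i))"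

definition feasible_set :: "('n \<Rightarrow> real^'d \<Rightarrow> real^'m) \<Rightarrow> (real^'d) set"
  where "feasible_set h = {s. \<forall>i. h i s = 0}"

definition stacked_feasible_set :: "('n \<Rightarrow> real^'d \<Rightarrow> real^'m) \<Rightarrow> (real^'d^'n) set"
  where "stacked_feasible_set h = ones_kron ` feasible_set h"

definition aggregate_cost :: "('n::finite \<Rightarrow> real^'d \<Rightarrow> real) \<Rightarrow> real^'d \<Rightarrow> real"
  where "aggregate_cost f s = (\<Sum>i\<in>UNIV. f i s)"

definition separable_cost :: "('n::finite \<Rightarrow> real^'d \<Rightarrow> real) \<Rightarrow> real^'d^'n \<Rightarrow> real"
  where "separable_cost f x = (\<Sum>i\<in>UNIV. f i (x $ i))"

definition local_minimizer_on :: "'a::metric_space set \<Rightarrow> ('a \<Rightarrow> real) \<Rightarrow> 'a \<Rightarrow> bool"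
  where "local_minimizer_on S F s \<longleftrightarrow> s \<in> S \<and> (\<exists>e>0. \<forall>y\<in>S. dist y s < e \<longrightarrow> F s \<le> F y)"

text \<open>The product of \<open>blkdiag(J\<^sub>1(x\<^sub>1), \<dots>, J\<^sub>N(x\<^sub>N))\<^sup>T\<close> with \<open>col(\<mu>\<^sub>1, \<dots>, \<mu>\<^sub>N)\<close>.\<close>

definition blkdiag_jacobian_transpose ::
    "('n \<Rightarrow> real^'d \<Rightarrow> real^'m) \<Rightarrow> real^'d^'n \<Rightarrow> real^'m^'n \<Rightarrow> real^'d^'n"
  where "blkdiag_jacobian_transpose h x \<mu> =
    (\<chi> i. transpose (jacobian (h i) (at (x $ i))) *v (\<mu> $ i))"

text \<open>The matrix \<open>col(J\<^sub>1(x\<^sub>1), \<dots>, J\<^sub>N(x\<^sub>N))\<close>, with rows indexed by pairs.  Rows \<open>(i, k)\<close> with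
  \<open>k \<notin> idx i\<close> vanish when \<open>h i\<close> takes values in \<open>block_space (idx i)\<close>, so they do not affect the
  rank.\<close>

definition col_jacobian ::
    "('n::finite \<Rightarrow> real^'d \<Rightarrow> real^'m::finite) \<Rightarrow> real^'d^'n \<Rightarrow> real^'d^('n \<times> 'm)"
  where "col_jacobian h x = (\<chi> p. jacobian (h (fst p)) (at (x $ fst p)) $ snd p)"

subsection \<open>Solutions, equilibria and stability\<close>

definition solves_ode_in :: "'a::real_normed_vector set \<Rightarrow> ('a \<Rightarrow> 'a) \<Rightarrow> (real \<Rightarrow> 'a) \<Rightarrow> bool"
  where "solves_ode_in S F y \<longleftrightarrow>
    (\<forall>t\<ge>0. y t \<in> S \<and> (y has_vector_derivative F (y t)) (at t within {0..}))"

text \<open>Existence of solutions for all forward time is part of the stability notions below: a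
  bound on the globally defined solutions alone would say nothing about solutions that blow up.\<close>

definition origin_globally_exp_stable ::
    "'a::real_normed_vector set \<Rightarrow> ('a \<Rightarrow> 'a) \<Rightarrow> real \<Rightarrow> bool"
  where "origin_globally_exp_stable S F \<alpha> \<longleftrightarrow>
    (\<forall>y0\<in>S. \<exists>y. solves_ode_in S F y \<and> y 0 = y0) \<and>
    (\<exists>c. \<forall>y. solves_ode_in S F y \<longrightarrow> (\<forall>t\<ge>0. norm (y t) \<le> c * exp (- \<alpha> * t) * norm (y 0)))"

text \<open>Here \<open>E\<close> is the property of being an equilibrium (or fixed point).\<close>

definition locally_unique_in :: "'a::topological_space set \<Rightarrow> ('a \<Rightarrow> bool) \<Rightarrow> 'a \<Rightarrow> bool"
  where "locally_unique_in S E p \<longleftrightarrow>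
    p \<in> S \<and> E p \<and> (\<exists>U. open U \<and> p \<in> U \<and> (\<forall>q\<in>S \<inter> U. E q \<longrightarrow> q = p))"

subsection \<open>The output vector field and the two dynamics\<close>

definition output_space :: "real^'n^'n \<Rightarrow> ('n \<Rightarrow> 'm set) \<Rightarrow> ((real^'d^'n) \<times> (real^'m^'n)) set"
  where "output_space A idx = range (lap A) \<times> stacked_space idx"

definition output_field ::
    "('n \<Rightarrow> real^'d \<Rightarrow> real^'d) \<Rightarrow> ('n \<Rightarrow> real^'m \<Rightarrow> real^'m) \<Rightarrow>
     (real^'d^'n) \<times> (real^'m^'n) \<Rightarrow> (real^'d^'n) \<times> (real^'m^'n)"
  where "output_field Gg Gh = (\<lambda>(yg, yh). (stack Gg yg, stack Gh yh))"

text \<open>States are \<open>(x, z)\<close> with \<open>z = (z\<^sub>c, z\<^sub>h)\<close>.\<close>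

type_synonym ('d, 'm, 'n) state = "(real^'d^'n) \<times> (real^'d^'n) \<times> (real^'m^'n)"

definition state_space :: "real^'n^'n \<Rightarrow> ('n \<Rightarrow> 'm set) \<Rightarrow> ('d::finite, 'm::finite, 'n::finite) state set"
  where "state_space A idx = UNIV \<times> range (lap A) \<times> stacked_space idx"

definition sp_field ::
    "real^'n^'n \<Rightarrow> ('n \<Rightarrow> real^'d \<Rightarrow> real) \<Rightarrow> ('n \<Rightarrow> real^'d \<Rightarrow> real^'m) \<Rightarrow>
     ('n \<Rightarrow> real^'d \<Rightarrow> real^'d) \<Rightarrow> ('n \<Rightarrow> real^'m \<Rightarrow> real^'m) \<Rightarrow> real \<Rightarrow> real \<Rightarrow>
     ('d, 'm, 'n) state \<Rightarrow> ('d, 'm, 'n) state"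
  where "sp_field A f h Gg Gh Kpc Kph = (\<lambda>(x, zc, zh).
    let v = Kpc *\<^sub>R lap A x + zc;
        \<mu> = Kph *\<^sub>R stack h x + zh
    in (- gradient (separable_cost f) x - v - blkdiag_jacobian_transpose h x \<mu>,
        - (Kpc *\<^sub>R stack Gg (lap A x)),
        - (Kph *\<^sub>R stack Gh (stack h x))))"

definition fs_nde_step ::
    "real^'n^'n \<Rightarrow> ('n \<Rightarrow> real^'d \<Rightarrow> real) \<Rightarrow> ('n \<Rightarrow> real^'d \<Rightarrow> real^'m) \<Rightarrow>
     ('n \<Rightarrow> real^'d \<Rightarrow> real^'d) \<Rightarrow> ('n \<Rightarrow> real^'m \<Rightarrow> real^'m) \<Rightarrow> real \<Rightarrow> real \<Rightarrow> real \<Rightarrow>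
     ('d, 'm, 'n) state \<Rightarrow> ('d, 'm, 'n) state"
  where "fs_nde_step A f h Gg Gh Kpc Kph T = (\<lambda>(x, zc, zh).
    let v = Kpc *\<^sub>R lap A x + zc;
        \<mu> = Kph *\<^sub>R stack h x + zh
    in (x - T *\<^sub>R (gradient (separable_cost f) x + v + blkdiag_jacobian_transpose h x \<mu>),
        zc - (T * Kpc) *\<^sub>R stack Gg (lap A x),
        zh - (T * Kph) *\<^sub>R stack Gh (stack h x)))"

definition state_dist :: "('d::finite, 'm::finite, 'n::finite) state \<Rightarrow> ('d, 'm, 'n) state \<Rightarrow> real"
  where "state_dist p q = norm (fst p - fst q) + norm (snd p - snd q)"

definition state_error ::
    "real^'n^'n \<Rightarrow> ('n \<Rightarrow> real^'d \<Rightarrow> real^'m) \<Rightarrow> ('d, 'm, 'n) state \<Rightarrow> ('d, 'm, 'n) state \<Rightarrow> real"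
  where "state_error A h p q =
    state_dist p q + norm (lap A (fst p)) + norm (stack h (fst p))"

definition is_sp_threshold ::
    "real^'n^'n \<Rightarrow> ('n \<Rightarrow> 'm set) \<Rightarrow> ('n \<Rightarrow> real^'d \<Rightarrow> real) \<Rightarrow> ('n \<Rightarrow> real^'d \<Rightarrow> real^'m) \<Rightarrow>
     ('n \<Rightarrow> real^'d \<Rightarrow> real^'d) \<Rightarrow> ('n \<Rightarrow> real^'m \<Rightarrow> real^'m) \<Rightarrow> real \<Rightarrow> real \<Rightarrow>
     real^'d^'n \<Rightarrow> real \<Rightarrow> real \<Rightarrow> bool"
  where "is_sp_threshold A idx f h Gg Gh K0c K0h xs \<alpha> \<tau>s \<longleftrightarrow>
    \<tau>s > 0 \<and>
    (\<forall>\<tau>. 0 < \<tau> \<and> \<tau> < \<tau>s \<longrightarrow>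
      (let S = state_space A idx; V = sp_field A f h Gg Gh (K0c / \<tau>) (K0h / \<tau>) in
       \<exists>zs. locally_unique_in S (\<lambda>p. V p = 0) (xs, zs) \<and>
         (\<exists>C>0. \<exists>\<delta>>0. \<forall>p0\<in>S. state_dist p0 (xs, zs) < \<delta> \<longrightarrow>
            (\<exists>p. solves_ode_in S V p \<and> p 0 = p0) \<and>
            (\<forall>p. solves_ode_in S V p \<and> p 0 = p0 \<longrightarrow>
               (\<forall>t\<ge>0. state_error A h (p t) (xs, zs)
                        \<le> C * exp (- \<alpha> * t) * state_dist p0 (xs, zs))))))"

end

theory Submission
  imports Defs
begin

text \<open>
  FS-NDE is the explicit Euler discretization, with step \<open>T\<close>, of the continuous-time realization
  \<open>p' = V p\<close>: one step maps \<open>p\<close> to \<open>p + T V(p)\<close>.  For \<open>T > 0\<close> its fixed points are the zeros of \<open>V\<close>,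
  so the locally unique equilibrium is inherited from the threshold property.  What remains
  is a general fact about Euler's method: if the flow contracts towards an equilibrium \<open>q\<close> at rate
  \<open>\<alpha>\<close> and \<open>V\<close> is Lipschitz near \<open>q\<close>, then for every \<open>\<beta> < \<alpha>\<close> and every small enough \<open>T\<close> the Euler
  iterates contract at rate \<open>\<beta>\<close> (\<open>euler_inherits_exp_stability\<close>).

  No linearization is used.  Choose a horizon \<open>t\<^sub>0\<close> so long that the flow, with its constant \<open>C\<close>,
  satisfies \<open>C exp(-\<alpha> t) \<le> exp(-\<beta> t) / 2\<close> for \<open>t \<ge> t\<^sub>0\<close>.  Over a time span of length about \<open>t\<^sub>0\<close> the
  Euler iterates differ from the flow by at most \<open>D T |p - q|\<close>, where \<open>D\<close> does not depend on the
  starting point \<open>p\<close> or on \<open>T\<close> (\<open>euler_tracks_flow\<close>).  The factor \<open>|p - q|\<close> is decisive: it is there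
  because \<open>V\<close> vanishes at \<open>q\<close>, so along the solution both \<open>V\<close> and the local truncation errors
  are proportional to \<open>|p - q|\<close>.  For small \<open>T\<close> the deviation is therefore below
  \<open>exp(-\<beta> t) |p - q| / 2\<close>, and a block of \<open>n \<approx> t\<^sub>0 / T\<close> steps contracts by \<open>exp(-\<beta> n T)\<close>.  Inside a
  block the iterates grow by a bounded factor, so iterating over blocks gives geometric decay
  (\<open>block_contraction_imp_geometric\<close>).

  To apply this, \<open>V\<close> has to be Lipschitz near the equilibrium on the admissible state space
  (\<open>lipschitz_near_sp_field\<close>) and the output terms \<open>L x\<close> and \<open>h(x)\<close>, which vanish at the
  equilibrium, have to be bounded by the distance to it (\<open>state_error_le_norm\<close>).
\<close>

section \<open>Exponential stability under Euler discretization\<close>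

definition euler_step :: "('a::real_normed_vector \<Rightarrow> 'a) \<Rightarrow> real \<Rightarrow> 'a \<Rightarrow> 'a"
  where "euler_step V T p = p + T *\<^sub>R V p"

lemma euler_step_iterate_in:
  assumes "\<And>p. p \<in> S \<Longrightarrow> euler_step V T p \<in> S" "p \<in> S"
  shows "(euler_step V T ^^ k) p \<in> S"
  using assms by (induction k) auto

lemma power_one_plus_le_exp:
  fixes x :: real
  assumes "x \<ge> 0"
  shows "(1 + x) ^ k \<le> exp (x * real k)"
proof -
  have "(1 + x) ^ k \<le> exp x ^ k"
    using assms by (intro power_mono) auto
  then show ?thesis
    by (simp add: exp_of_nat2_mult)
qed

text \<open>One step expands the distance to the zero \<open>q\<close> of \<open>V\<close> by at most \<open>1 + L T\<close>, as long as the
  iterates stay where \<open>V\<close> is Lipschitz.  The smallness condition on the starting point guarantees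
  this for \<open>k\<close> steps.\<close>

lemma euler_growth:
  fixes V :: "'a::real_normed_vector \<Rightarrow> 'a"
  assumes lip: "L-lipschitz_on (cball q r \<inter> S) V"
    and q: "q \<in> S" "V q = 0"
    and inv: "\<And>p. p \<in> S \<Longrightarrow> euler_step V T p \<in> S"
    and T: "T \<ge> 0" and p: "p \<in> S"
    and small: "exp (L * T * real k) * norm (p - q) \<le> r"
  shows "norm ((euler_step V T ^^ k) p - q) \<le> exp (L * T * real k) * norm (p - q)"
proof -
  have L: "L \<ge> 0"
    using lip by (rule lipschitz_on_nonneg)
  have "norm ((euler_step V T ^^ j) p - q) \<le> (1 + L * T) ^ j * norm (p - q)" if "j \<le> k" for j
    using that
  proof (induction j)
    case 0
    then show ?case by simp
  next
    case (Suc j)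
    define u where "u = (euler_step V T ^^ j) p"
    have u: "norm (u - q) \<le> (1 + L * T) ^ j * norm (p - q)"
      using Suc by (simp add: u_def)
    have "(1 + L * T) ^ j \<le> exp (L * T * real j)"
      using L T by (intro power_one_plus_le_exp) simp
    also have "\<dots> \<le> exp (L * T * real k)"
      using L T Suc.prems by (simp add: mult_left_mono)
    finally have "norm (u - q) \<le> exp (L * T * real k) * norm (p - q)"
      using u by (meson mult_right_mono norm_ge_zero order_trans)
    then have "norm (u - q) \<le> r"
      using small by linarith
    moreover have "u \<in> S"
      unfolding u_def using inv p by (rule euler_step_iterate_in)
    moreover have "r \<ge> 0"
      using \<open>norm (u - q) \<le> r\<close> norm_ge_zero order_trans by blast
    ultimately have "norm (V u - V q) \<le> L * norm (u - q)"
      using q by (intro lipschitz_on_normD[OF lip]) (auto simp: dist_norm norm_minus_commute)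
    then have "norm (u + T *\<^sub>R V u - q) \<le> norm (u - q) + T * (L * norm (u - q))"
      using norm_triangle_ineq[of "u - q" "T *\<^sub>R V u"] T q
      by (smt (verit) add_diff_eq add.commute diff_zero mult_left_mono norm_scaleR diff_add_eq)
    also have "\<dots> = (1 + L * T) * norm (u - q)"
      by (simp add: algebra_simps)
    also have "\<dots> \<le> (1 + L * T) * ((1 + L * T) ^ j * norm (p - q))"
      using u L T by (intro mult_left_mono) auto
    finally have "norm (euler_step V T u - q) \<le> (1 + L * T) ^ Suc j * norm (p - q)"
      by (simp add: euler_step_def mult.assoc)
    then show ?case
      by (simp add: u_def)
  qed
  from this[OF order_refl] have "norm ((euler_step V T ^^ k) p - q) \<le> (1 + L * T) ^ k * norm (p - q)" .
  also have "\<dots> \<le> exp (L * T * real k) * norm (p - q)"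
    using L T by (intro mult_right_mono power_one_plus_le_exp) auto
  finally show ?thesis .
qed

text \<open>On a solution that stays within \<open>B\<close> of \<open>q\<close> the speed is at most \<open>L B\<close>, so in time \<open>T\<close> the velocity
  changes by a multiple of \<open>L (L B T)\<close>.  Hence the local error of Euler's method is of second order
  in \<open>T\<close> and of first order in \<open>B\<close>; a Lipschitz field suffices because no second derivative of the
  solution is used.\<close>

lemma solution_one_step_defect:
  fixes V :: "'a::real_normed_vector \<Rightarrow> 'a"
  assumes lip: "L-lipschitz_on (cball q r \<inter> S) V"
    and q: "q \<in> S" "V q = 0"
    and y: "solves_ode_in S V y"
    and B: "\<And>t. t \<ge> 0 \<Longrightarrow> norm (y t - q) \<le> B" "B \<le> r"
    and a: "a \<ge> 0" and T: "T \<ge> 0"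
  shows "norm (y (a + T) - euler_step V T (y a)) \<le> 3 * L\<^sup>2 * B * T\<^sup>2"
proof -
  have L: "L \<ge> 0"
    using lip by (rule lipschitz_on_nonneg)
  have B0: "B \<ge> 0"
    using B(1)[of 0] norm_ge_zero[of "y 0 - q"] by linarith
  have mem: "y t \<in> cball q r \<inter> S" if "t \<ge> 0" for t
    using B(1)[OF that] B(2) y that by (auto simp: solves_ode_in_def dist_norm norm_minus_commute)
  have qmem: "q \<in> cball q r \<inter> S"
    using q B0 B(2) by auto
  have V: "norm (V (y t)) \<le> L * B" if "t \<ge> 0" for t
  proof -
    have "norm (V (y t) - V q) \<le> L * norm (y t - q)"
      using lip mem[OF that] qmem by (rule lipschitz_on_normD)
    also have "\<dots> \<le> L * B"
      using B(1)[OF that] L by (rule mult_left_mono)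
    finally show ?thesis
      using q by simp
  qed
  \<comment> \<open>The mean value inequality for \<open>s \<mapsto> y s - (s - a) V (y a)\<close>; it is applied twice, first with the
    crude bound \<open>2 L B\<close> on the variation of the velocity and then with the bound of order \<open>T\<close>
    that results.\<close>
  have lin: "norm (y b - y a - (b - a) *\<^sub>R V (y a)) \<le> (b - a) * D"
    if b: "b \<ge> a" and D: "\<And>s. a \<le> s \<Longrightarrow> s \<le> b \<Longrightarrow> norm (V (y s) - V (y a)) \<le> D" for b D
  proof -
    have "norm (y b - y a - (b - a) *\<^sub>R V (y a)) \<le> norm (b - a) * D"
    proof (rule vector_differentiable_bound_linearization[where S = "{a..b}" and f' = "\<lambda>s. V (y s)"])
      show "(y has_vector_derivative V (y x)) (at x within {a..b})" if "x \<in> {a..b}" for x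
        using y that a unfolding solves_ode_in_def
        by (intro has_vector_derivative_within_subset[where S = "{0..}" and T = "{a..b}"]) auto
    qed (use b D in \<open>auto simp: closed_segment_eq_real_ivl\<close>)
    then show ?thesis
      using b by simp
  qed
  have move: "norm (y s - y a) \<le> T * (3 * L * B)" if s: "a \<le> s" "s \<le> a + T" for s
  proof -
    have "norm (V (y u) - V (y a)) \<le> 2 * L * B" if "a \<le> u" for u
      using norm_triangle_ineq4[of "V (y u)" "V (y a)"] V[of u] V[of a] a that by linarith
    then have "norm (y s - y a - (s - a) *\<^sub>R V (y a)) \<le> (s - a) * (2 * L * B)"
      using s by (intro lin) auto
    moreover have "norm ((s - a) *\<^sub>R V (y a)) \<le> (s - a) * (L * B)"
      using V[OF a] s by (simp add: mult_left_mono)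
    ultimately have "norm (y s - y a) \<le> (s - a) * (2 * L * B) + (s - a) * (L * B)"
      using norm_triangle_ineq[of "y s - y a - (s - a) *\<^sub>R V (y a)" "(s - a) *\<^sub>R V (y a)"]
      by (simp only: diff_add_cancel)
    also have "\<dots> = (s - a) * (3 * L * B)"
      by (simp add: algebra_simps)
    also have "\<dots> \<le> T * (3 * L * B)"
      using s L B0 by (intro mult_right_mono) auto
    finally show ?thesis .
  qed
  have "norm (V (y s) - V (y a)) \<le> L * (T * (3 * L * B))" if s: "a \<le> s" "s \<le> a + T" for s
  proof -
    have "norm (V (y s) - V (y a)) \<le> L * norm (y s - y a)"
      using a s by (intro lipschitz_on_normD[OF lip] mem) auto
    then show ?thesis
      using move[OF s] L by (meson mult_left_mono order_trans)
  qed
  then have "norm (y (a + T) - y a - (a + T - a) *\<^sub>R V (y a)) \<le> (a + T - a) * (L * (T * (3 * L * B)))"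
    using T by (intro lin) auto
  then show ?thesis
    by (simp add: euler_step_def power2_eq_square algebra_simps)
qed

text \<open>The discrete Gronwall argument: the defects of the single steps accumulate additively, and
  each of them is amplified by at most \<open>exp(L k T)\<close>.  With \<open>k T\<close> bounded, the total error is of
  order \<open>B T\<close>.\<close>

lemma euler_tracks_flow:
  fixes V :: "'a::real_normed_vector \<Rightarrow> 'a"
  assumes lip: "L-lipschitz_on (cball q r \<inter> S) V"
    and q: "q \<in> S" "V q = 0"
    and inv: "\<And>p. p \<in> S \<Longrightarrow> euler_step V T p \<in> S"
    and y: "solves_ode_in S V y"
    and B: "\<And>t. t \<ge> 0 \<Longrightarrow> norm (y t - q) \<le> B" "B \<le> r"
    and T: "T \<ge> 0"
    and small: "exp (L * T * real k) * norm (y 0 - q) \<le> r"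
  shows "norm (y (real k * T) - (euler_step V T ^^ k) (y 0))
    \<le> exp (L * T * real k) * (real k * T) * (3 * L\<^sup>2 * B) * T"
proof -
  have L: "L \<ge> 0"
    using lip by (rule lipschitz_on_nonneg)
  have B0: "B \<ge> 0"
    using B(1)[of 0] norm_ge_zero[of "y 0 - q"] by linarith
  have y_in: "y t \<in> S" if "t \<ge> 0" for t
    using y that by (simp add: solves_ode_in_def)
  define E where "E = 3 * L\<^sup>2 * B * T\<^sup>2"
  have E: "E \<ge> 0"
    using B0 by (simp add: E_def)
  have "norm (y (real j * T) - (euler_step V T ^^ j) (y 0)) \<le> (1 + L * T) ^ j * (real j * E)"
    if "j \<le> k" for j
    using that
  proof (induction j)
    case 0
    then show ?case by simp
  next
    case (Suc j)
    define a where "a = real j * T"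
    define u where "u = (euler_step V T ^^ j) (y 0)"
    have a: "a \<ge> 0"
      using T by (simp add: a_def)
    have IH: "norm (y a - u) \<le> (1 + L * T) ^ j * (real j * E)"
      using Suc by (simp add: a_def u_def)
    have mono: "exp (L * T * real j) \<le> exp (L * T * real k)"
      using L T Suc.prems by (simp add: mult_left_mono)
    then have small': "exp (L * T * real j) * norm (y 0 - q) \<le> r"
      using small by (meson mult_right_mono norm_ge_zero order_trans)
    then have "norm (u - q) \<le> r"
      using euler_growth[OF lip q inv T y_in small'] by (simp add: u_def)
    moreover have "u \<in> S"
      unfolding u_def using inv y_in by (intro euler_step_iterate_in) auto
    ultimately have "norm (V (y a) - V u) \<le> L * norm (y a - u)"
      using B(1)[OF a] B(2) y_in[OF a]
      by (intro lipschitz_on_normD[OF lip]) (auto simp: dist_norm norm_minus_commute)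
    then have "norm (T *\<^sub>R (V (y a) - V u)) \<le> T * (L * norm (y a - u))"
      using T by (simp add: mult_left_mono)
    moreover have "norm (y (a + T) - euler_step V T (y a)) \<le> E"
      unfolding E_def using lip q y B a T by (rule solution_one_step_defect)
    \<comment> \<open>The new error is the local defect at \<open>y a\<close> plus the old error propagated by one Euler step.\<close>
    moreover have "norm (y (a + T) - euler_step V T u)
        \<le> norm (y (a + T) - euler_step V T (y a)) + (norm (y a - u) + norm (T *\<^sub>R (V (y a) - V u)))"
    proof -
      have "y (a + T) - euler_step V T u
          = (y (a + T) - euler_step V T (y a)) + ((y a - u) + T *\<^sub>R (V (y a) - V u))"
        by (simp add: euler_step_def algebra_simps)
      then show ?thesis
        by (metis norm_triangle_mono norm_triangle_ineq order_refl)
    qed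
    ultimately have "norm (y (a + T) - euler_step V T u) \<le> E + (norm (y a - u) + T * (L * norm (y a - u)))"
      by linarith
    also have "\<dots> = E + (1 + L * T) * norm (y a - u)"
      by (simp add: algebra_simps)
    also have "\<dots> \<le> (1 + L * T) ^ Suc j * E + (1 + L * T) * ((1 + L * T) ^ j * (real j * E))"
    proof (intro add_mono mult_left_mono IH)
      have "1 \<le> (1 + L * T) ^ Suc j"
        using L T by (intro one_le_power) simp
      then show "E \<le> (1 + L * T) ^ Suc j * E"
        using E by (simp add: mult_le_cancel_right1)
    qed (use L T in auto)
    also have "\<dots> = (1 + L * T) ^ Suc j * (real (Suc j) * E)"
      by (simp add: algebra_simps)
    finally show ?case
      by (simp add: a_def u_def algebra_simps)
  qed
  from this[OF order_refl]
  have "norm (y (real k * T) - (euler_step V T ^^ k) (y 0)) \<le> (1 + L * T) ^ k * (real k * E)" .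
  also have "\<dots> \<le> exp (L * T * real k) * (real k * E)"
    using L T E by (intro mult_right_mono power_one_plus_le_exp) auto
  finally show ?thesis
    by (simp add: E_def power2_eq_square algebra_simps)
qed

text \<open>A map that contracts only in blocks of \<open>n\<close> steps still decays geometrically: the smallness
  condition is recovered at the start of each block, and the loss within a block is a constant
  factor.\<close>

lemma block_contraction_imp_geometric:
  fixes g :: "'a \<Rightarrow> 'a" and d :: "'a \<Rightarrow> real" and q :: real
  assumes inv: "\<And>p. p \<in> S \<Longrightarrow> g p \<in> S"
    and d: "\<And>p. d p \<ge> 0"
    and n: "n > 0" and q: "0 < q" "q \<le> 1" and M: "M \<ge> 0"
    and within: "\<And>p j. p \<in> S \<Longrightarrow> d p < \<delta> \<Longrightarrow> j \<le> n \<Longrightarrow> d ((g ^^ j) p) \<le> M * d p"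
    and block: "\<And>p. p \<in> S \<Longrightarrow> d p < \<delta> \<Longrightarrow> d ((g ^^ n) p) \<le> q ^ n * d p"
    and p: "p \<in> S" "d p < \<delta>"
  shows "d ((g ^^ k) p) \<le> M / q ^ n * q ^ k * d p"
proof -
  have S: "(g ^^ j) p \<in> S" for j
    using inv p(1) by (induction j) auto
  have start: "d ((g ^^ (n * m)) p) \<le> q ^ (n * m) * d p" for m
  proof (induction m)
    case 0
    then show ?case by simp
  next
    case (Suc m)
    have "q ^ (n * m) * d p \<le> d p"
      using q d[of p] by (intro mult_left_le_one_le power_le_one) auto
    with Suc p have "d ((g ^^ n) ((g ^^ (n * m)) p)) \<le> q ^ n * d ((g ^^ (n * m)) p)"
      by (intro block S) linarith
    also have "\<dots> \<le> q ^ n * (q ^ (n * m) * d p)"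
      using Suc q by (intro mult_left_mono) auto
    finally show ?case
      by (simp add: funpow_add power_add mult.assoc)
  qed
  define m j where "m = k div n" and "j = k mod n"
  have k: "k = j + n * m" and j: "j \<le> n"
    using n by (simp_all add: m_def j_def less_imp_le)
  have "q ^ (n * m) * d p \<le> d p"
    using q d[of p] by (intro mult_left_le_one_le power_le_one) auto
  with start[of m] p have "d ((g ^^ j) ((g ^^ (n * m)) p)) \<le> M * d ((g ^^ (n * m)) p)"
    by (intro within S j) linarith
  also have "\<dots> \<le> M * (q ^ (n * m) * d p)"
    using start M by (intro mult_left_mono)
  also have "\<dots> \<le> M * (q ^ k / q ^ n * d p)"
  proof (intro mult_left_mono mult_right_mono)
    have "q ^ (n * m) * q ^ n \<le> q ^ (n * m) * q ^ j"
      using q j by (intro mult_left_mono power_decreasing) auto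
    then show "q ^ (n * m) \<le> q ^ k / q ^ n"
      using q by (simp add: k power_add field_simps)
  qed (use M d in auto)
  finally show ?thesis
    by (simp add: k funpow_add)
qed

text \<open>Over a long enough horizon the gap between \<open>\<alpha>\<close> and \<open>\<beta>\<close> absorbs the factor \<open>C\<close> of the flow and
  leaves room for a relative discretization error, which is below that margin once \<open>T\<close> is small.  The constants \<open>K\<close> and
  \<open>\<epsilon>\<close> are uniform in the step size.\<close>

lemma euler_inherits_exp_stability:
  fixes V :: "'a::real_normed_vector \<Rightarrow> 'a"
  assumes lip: "L-lipschitz_on (cball q r \<inter> S) V" and r: "r > 0"
    and q: "q \<in> S" "V q = 0"
    and inv: "\<And>p T. p \<in> S \<Longrightarrow> euler_step V T p \<in> S"
    and C: "C > 0" and \<delta>: "\<delta> > 0"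
    and stable: "\<And>p. p \<in> S \<Longrightarrow> norm (p - q) < \<delta> \<Longrightarrow>
      \<exists>y. solves_ode_in S V y \<and> y 0 = p \<and>
        (\<forall>t\<ge>0. norm (y t - q) \<le> C * exp (- \<alpha> * t) * norm (p - q))"
    and \<beta>: "0 < \<beta>" "\<beta> < \<alpha>"
  obtains Ts K \<epsilon> where "Ts > 0" "K > 0" "\<epsilon> > 0"
    "\<forall>T p k. 0 < T \<and> T < Ts \<and> p \<in> S \<and> norm (p - q) < \<epsilon> \<longrightarrow>
      norm ((euler_step V T ^^ k) p - q) \<le> K * exp (- \<beta> * real k * T) * norm (p - q)"
proof -
  have L: "L \<ge> 0"
    using lip by (rule lipschitz_on_nonneg)
  \<comment> \<open>\<open>t0\<close> is the horizon after which the flow beats the rate \<open>\<beta>\<close> with a factor 2 to spare; \<open>M\<close> bounds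
    the growth of the iterates within a block, and \<open>D T\<close> bounds the relative deviation from the
    flow at its end.  The summand 1 in \<open>D\<close> makes \<open>D\<close> positive also for \<open>L = 0\<close>, and the radius
    \<open>\<epsilon>\<close> keeps solution and iterates in the ball where \<open>V\<close> is Lipschitz.\<close>
  define t0 where "t0 = max 1 (ln (2 * C) / (\<alpha> - \<beta>))"
  define M where "M = exp (L * (t0 + 1))"
  define D where "D = M * (t0 + 1) * (3 * L\<^sup>2 * C) + 1"
  define Ts where "Ts = min 1 (exp (- \<beta> * (t0 + 1)) / (2 * D))"
  define \<epsilon> where "\<epsilon> = min \<delta> (min (r / C) (r / M))"
  have t0: "t0 \<ge> 1"
    by (simp add: t0_def)
  have M: "M \<ge> 1"
    using L t0 by (simp add: M_def)
  have D: "D > 0"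
    using M t0 C by (simp add: D_def add_nonneg_pos)
  have half: "C * exp (- (\<alpha> - \<beta>) * t) \<le> 1 / 2" if "t \<ge> t0" for t
  proof -
    have "ln (2 * C) / (\<alpha> - \<beta>) \<le> t"
      using that by (simp add: t0_def)
    then have "ln (2 * C) \<le> (\<alpha> - \<beta>) * t"
      using \<beta> by (simp add: field_simps)
    then have "exp (ln (2 * C)) * exp (- (\<alpha> - \<beta>) * t) \<le> 1"
      by (simp only: exp_add[symmetric]) (simp add: algebra_simps)
    then show ?thesis
      using C by simp
  qed
  have main: "norm ((euler_step V T ^^ k) p - q)
        \<le> M * exp (\<beta> * (t0 + 1)) * exp (- \<beta> * real k * T) * norm (p - q)"
    if T: "0 < T" "T < Ts" and p: "p \<in> S" "norm (p - q) < \<epsilon>" for T p k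
  proof -
    \<comment> \<open>\<open>n T\<close> lies in \<open>[t0, t0 + 1]\<close>, so all bounds on a block can be stated without \<open>T\<close>.\<close>
    define n where "n = nat \<lceil>t0 / T\<rceil>"
    have T1: "T \<le> 1"
      using T by (simp add: Ts_def)
    have n_low: "real n * T \<ge> t0"
    proof -
      have "real n \<ge> t0 / T"
        by (simp add: n_def real_nat_ceiling_ge)
      then show ?thesis
        using T by (simp add: field_simps)
    qed
    have n_up: "real n * T \<le> t0 + 1"
    proof -
      have "real n \<le> t0 / T + 1"
        using T t0 by (simp add: n_def)
      then have "real n * T \<le> (t0 / T + 1) * T"
        using T by (intro mult_right_mono) auto
      also have "\<dots> = t0 + T"
        using T by (simp add: field_simps)
      finally show ?thesis
        using T1 by simp
    qed
    have n0: "n > 0"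
      using n_low t0 by (cases n) auto
    have expM: "exp (L * T * real j) \<le> M" if "j \<le> n" for j
    proof -
      have "L * T * real j \<le> L * T * real n"
        using that L T by (intro mult_left_mono) auto
      also have "\<dots> = L * (real n * T)"
        by simp
      also have "\<dots> \<le> L * (t0 + 1)"
        using n_up L by (rule mult_left_mono)
      finally show ?thesis
        by (simp add: M_def)
    qed
    have Mr: "exp (L * T * real j) * norm (p - q) \<le> r" if "j \<le> n" "norm (p - q) < \<epsilon>" for j p
    proof -
      have "exp (L * T * real j) * norm (p - q) \<le> M * (r / M)"
        using that expM[OF that(1)] M by (intro mult_mono) (auto simp: \<epsilon>_def)
      then show ?thesis
        using M by simp
    qed
    have within: "norm ((euler_step V T ^^ j) p - q) \<le> M * norm (p - q)"
      if "p \<in> S" "norm (p - q) < \<epsilon>" "j \<le> n" for p j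
    proof -
      have "norm ((euler_step V T ^^ j) p - q) \<le> exp (L * T * real j) * norm (p - q)"
        using lip q inv less_imp_le[OF T(1)] that(1) Mr[OF that(3,2)] by (rule euler_growth)
      also have "\<dots> \<le> M * norm (p - q)"
        using expM[OF that(3)] by (intro mult_right_mono) auto
      finally show ?thesis .
    qed
    have block: "norm ((euler_step V T ^^ n) p - q) \<le> exp (- \<beta> * T) ^ n * norm (p - q)"
      if p: "p \<in> S" "norm (p - q) < \<epsilon>" for p
    proof -
      obtain y where y: "solves_ode_in S V y" "y 0 = p"
        and decay: "\<And>t. t \<ge> 0 \<Longrightarrow> norm (y t - q) \<le> C * exp (- \<alpha> * t) * norm (p - q)"
        using stable[of p] p by (auto simp: \<epsilon>_def)
      have y_bound: "norm (y t - q) \<le> C * norm (p - q)" if "t \<ge> 0" for t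
      proof -
        have "C * exp (- \<alpha> * t) * norm (p - q) \<le> C * 1 * norm (p - q)"
          using that C \<beta> by (intro mult_right_mono mult_left_mono) auto
        then show ?thesis
          using decay[OF that] by simp
      qed
      have Cr: "C * norm (p - q) \<le> r"
        using p(2) C by (simp add: \<epsilon>_def field_simps)
      have "exp (L * T * real n) * norm (y 0 - q) \<le> r"
        using Mr[of n p] p y(2) by simp
      then have track: "norm (y (real n * T) - (euler_step V T ^^ n) (y 0))
          \<le> exp (L * T * real n) * (real n * T) * (3 * L\<^sup>2 * (C * norm (p - q))) * T"
        using lip q inv y(1) y_bound Cr T by (intro euler_tracks_flow) auto
      also have "\<dots> \<le> M * (t0 + 1) * (3 * L\<^sup>2 * (C * norm (p - q))) * T"
        using expM[of n] n_up M T C by (intro mult_right_mono mult_mono) auto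
      also have "\<dots> = (M * (t0 + 1) * (3 * L\<^sup>2 * C)) * T * norm (p - q)"
        by (simp add: algebra_simps)
      also have "\<dots> \<le> D * T * norm (p - q)"
        using T by (intro mult_right_mono) (auto simp: D_def)
      also have "\<dots> \<le> exp (- \<beta> * (t0 + 1)) / 2 * norm (p - q)"
      proof (rule mult_right_mono)
        have "T \<le> exp (- \<beta> * (t0 + 1)) / (2 * D)"
          using T by (simp add: Ts_def)
        then show "D * T \<le> exp (- \<beta> * (t0 + 1)) / 2"
          using D by (simp add: field_simps)
      qed simp
      also have "\<dots> \<le> exp (- \<beta> * (real n * T)) / 2 * norm (p - q)"
        using n_up \<beta> by (intro mult_right_mono divide_right_mono) auto
      finally have dev: "norm (y (real n * T) - (euler_step V T ^^ n) p)
          \<le> exp (- \<beta> * (real n * T)) / 2 * norm (p - q)"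
        using y(2) by simp
      have "norm (y (real n * T) - q) \<le> C * exp (- \<alpha> * (real n * T)) * norm (p - q)"
        using T by (intro decay) simp
      also have "C * exp (- \<alpha> * (real n * T))
          = C * exp (- (\<alpha> - \<beta>) * (real n * T)) * exp (- \<beta> * (real n * T))"
        by (simp only: mult.assoc exp_add[symmetric]) (simp add: algebra_simps)
      also have "\<dots> \<le> 1 / 2 * exp (- \<beta> * (real n * T))"
        using half[OF n_low] by (intro mult_right_mono) auto
      finally have flow: "norm (y (real n * T) - q) \<le> exp (- \<beta> * (real n * T)) / 2 * norm (p - q)"
        by (simp add: mult_right_mono)
      have "norm ((euler_step V T ^^ n) p - q) \<le> exp (- \<beta> * (real n * T)) * norm (p - q)"
        using dev flow norm_triangle_ineq4[of "y (real n * T) - q" "y (real n * T) - (euler_step V T ^^ n) p"]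
        by simp
      then show ?thesis
        by (simp add: exp_of_nat_mult[symmetric] algebra_simps)
    qed
    have "norm ((euler_step V T ^^ k) p - q)
        \<le> M / exp (- \<beta> * T) ^ n * exp (- \<beta> * T) ^ k * norm (p - q)"
      using inv n0 M T \<beta> within block p
      by (intro block_contraction_imp_geometric[where S = S and d = "\<lambda>p. norm (p - q)" and \<delta> = \<epsilon>]) auto
    also have "M / exp (- \<beta> * T) ^ n = M * exp (\<beta> * (real n * T))"
      by (simp add: exp_of_nat_mult[symmetric] exp_minus field_simps)
    also have "M * exp (\<beta> * (real n * T)) * exp (- \<beta> * T) ^ k * norm (p - q)
        \<le> M * exp (\<beta> * (t0 + 1)) * exp (- \<beta> * T) ^ k * norm (p - q)"
      using n_up \<beta> M by (intro mult_right_mono mult_left_mono) auto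
    also have "exp (- \<beta> * T) ^ k = exp (- \<beta> * real k * T)"
      by (simp add: exp_of_nat_mult[symmetric] algebra_simps)
    finally show ?thesis .
  qed
  have "Ts > 0" "M * exp (\<beta> * (t0 + 1)) > 0" "\<epsilon> > 0"
    using D M \<delta> r C by (auto simp: Ts_def \<epsilon>_def)
  moreover have "\<forall>T p k. 0 < T \<and> T < Ts \<and> p \<in> S \<and> norm (p - q) < \<epsilon> \<longrightarrow>
      norm ((euler_step V T ^^ k) p - q)
        \<le> M * exp (\<beta> * (t0 + 1)) * exp (- \<beta> * real k * T) * norm (p - q)"
    using main by blast
  ultimately show ?thesis
    by (rule that)
qed

section \<open>Maps that are Lipschitz near a point\<close>

text \<open>The regularity needed in the stability argument, local at one point and relative to a set.  The
  set is needed because the output field is assumed to be differentiable only along a subspace.\<close>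

definition lipschitz_near :: "'a::metric_space set \<Rightarrow> ('a \<Rightarrow> 'b::metric_space) \<Rightarrow> 'a \<Rightarrow> bool"
  where "lipschitz_near S g a \<longleftrightarrow> (\<exists>r>0. \<exists>L. L-lipschitz_on (cball a r \<inter> S) g)"

lemma lipschitz_nearE2:
  assumes "lipschitz_near S g a" "lipschitz_near S' g' a'"
  obtains r L M where "r > 0" "L-lipschitz_on (cball a r \<inter> S) g" "M-lipschitz_on (cball a' r \<inter> S') g'"
proof -
  obtain r1 L r2 M where *: "r1 > 0" "L-lipschitz_on (cball a r1 \<inter> S) g"
      "r2 > 0" "M-lipschitz_on (cball a' r2 \<inter> S') g'"
    using assms unfolding lipschitz_near_def by blast
  show ?thesis
  proof (rule that)
    show "L-lipschitz_on (cball a (min r1 r2) \<inter> S) g" "M-lipschitz_on (cball a' (min r1 r2) \<inter> S') g'"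
      using * by (auto elim!: lipschitz_on_subset)
  qed (use * in auto)
qed

lemma locally_Lipschitz_imp_lipschitz_near:
  assumes "locally_Lipschitz g"
  shows "lipschitz_near S g a"
proof -
  obtain u L where "u > 0" "\<forall>t\<in>cball 0 u \<inter> {0::real}. L-lipschitz_on (cball a u \<inter> UNIV) g"
    using assms unfolding locally_Lipschitz_def local_lipschitz_def by blast
  then have "u > 0" "L-lipschitz_on (cball a u) g"
    by auto
  then show ?thesis
    unfolding lipschitz_near_def by (blast intro: lipschitz_on_subset)
qed

lemma lipschitz_near_compose:
  assumes g: "lipschitz_near S g a" and k: "lipschitz_near S' k (g a)"
    and a: "a \<in> S" and into: "\<And>x. x \<in> S \<Longrightarrow> g x \<in> S'"
  shows "lipschitz_near S (\<lambda>x. k (g x)) a"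
proof -
  obtain r L M where r: "r > 0" and L: "L-lipschitz_on (cball a r \<inter> S) g"
      and M: "M-lipschitz_on (cball (g a) r \<inter> S') k"
    using g k by (rule lipschitz_nearE2)
  have L0: "L \<ge> 0"
    using L by (rule lipschitz_on_nonneg)
  define s where "s = r / (L + 1)"
  have s: "s > 0" "s \<le> r" "L * s \<le> r"
    using r L0 by (auto simp: s_def field_simps)
  have "g ` (cball a s \<inter> S) \<subseteq> cball (g a) r \<inter> S'"
  proof
    fix y
    assume "y \<in> g ` (cball a s \<inter> S)"
    then obtain x where x: "dist a x \<le> s" "x \<in> S" "y = g x"
      by auto
    have "dist (g a) (g x) \<le> L * dist a x"
      using x a s r by (intro lipschitz_onD[OF L]) auto
    also have "\<dots> \<le> L * s"
      using x L0 by (intro mult_left_mono)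
    finally show "y \<in> cball (g a) r \<inter> S'"
      using s x into by auto
  qed
  then have "(M * L)-lipschitz_on (cball a s \<inter> S) (k \<circ> g)"
    using s by (intro lipschitz_on_compose lipschitz_on_subset[OF L] lipschitz_on_subset[OF M]) auto
  with s show ?thesis
    by (auto simp: lipschitz_near_def o_def)
qed

lemma lipschitz_near_const: "lipschitz_near S (\<lambda>_. c) a"
  unfolding lipschitz_near_def using lipschitz_on_constant zero_less_one by blast

lemma lipschitz_near_linear:
  assumes "bounded_linear k"
  shows "lipschitz_near S k a"
proof -
  obtain B where "B-lipschitz_on (cball a 1 \<inter> S) k"
    using bounded_linear.lipschitz_boundE[OF assms] by metis
  then show ?thesis
    unfolding lipschitz_near_def using zero_less_one by blast
qed

lemma lipschitz_near_linear_compose: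
  assumes k: "bounded_linear k" and g: "lipschitz_near S g a" and a: "a \<in> S"
  shows "lipschitz_near S (\<lambda>x. k (g x)) a"
  by (rule lipschitz_near_compose[OF g lipschitz_near_linear[OF k] a UNIV_I])

lemma lipschitz_near_add:
  fixes g k :: "'a::metric_space \<Rightarrow> 'b::real_normed_vector"
  assumes "lipschitz_near S g a" "lipschitz_near S k a"
  shows "lipschitz_near S (\<lambda>x. g x + k x) a"
  using assms by (rule lipschitz_nearE2) (auto simp: lipschitz_near_def intro: lipschitz_on_add)

lemma lipschitz_near_minus:
  fixes g :: "'a::metric_space \<Rightarrow> 'b::real_normed_vector"
  assumes "lipschitz_near S g a"
  shows "lipschitz_near S (\<lambda>x. - g x) a"
  using assms unfolding lipschitz_near_def by (blast intro: lipschitz_on_minus)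

lemma lipschitz_near_diff:
  fixes g k :: "'a::metric_space \<Rightarrow> 'b::real_normed_vector"
  assumes "lipschitz_near S g a" "lipschitz_near S k a"
  shows "lipschitz_near S (\<lambda>x. g x - k x) a"
  using lipschitz_near_add[OF assms(1) lipschitz_near_minus[OF assms(2)]] by simp

lemma lipschitz_near_scaleR:
  fixes g :: "'a::metric_space \<Rightarrow> 'b::real_normed_vector"
  assumes "lipschitz_near S g a"
  shows "lipschitz_near S (\<lambda>x. c *\<^sub>R g x) a"
  using assms unfolding lipschitz_near_def by (blast intro: lipschitz_on_cmult)

lemma lipschitz_near_Pair:
  assumes "lipschitz_near S g a" "lipschitz_near S k a"
  shows "lipschitz_near S (\<lambda>x. (g x, k x)) a"
  using assms by (rule lipschitz_nearE2) (auto simp: lipschitz_near_def intro: lipschitz_on_Pair)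

lemma lipschitz_near_sum:
  fixes g :: "'i \<Rightarrow> 'a::metric_space \<Rightarrow> 'b::real_normed_vector"
  assumes "\<And>i. i \<in> I \<Longrightarrow> lipschitz_near S (g i) a"
  shows "lipschitz_near S (\<lambda>x. \<Sum>i\<in>I. g i x) a"
  using assms
  by (induction I rule: infinite_finite_induct) (auto intro: lipschitz_near_const lipschitz_near_add)

text \<open>The reason for the componentwise criterion is that gradients and Jacobians are given by their
  entries; a vector is the sum of its components along the axes.\<close>

lemma lipschitz_near_vec:
  fixes g :: "'a::metric_space \<Rightarrow> 'b::euclidean_space^'n"
  assumes g: "\<And>i. lipschitz_near S (\<lambda>x. g x $ i) a" and a: "a \<in> S"
  shows "lipschitz_near S g a"
proof -
  have axis: "bounded_linear (axis i :: 'b \<Rightarrow> 'b^'n)" for i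
  proof -
    have "linear (axis i :: 'b \<Rightarrow> 'b^'n)"
      by (auto intro!: linearI simp: vec_eq_iff axis_def)
    then show ?thesis
      by (simp add: linear_conv_bounded_linear)
  qed
  have "lipschitz_near S (\<lambda>x. \<Sum>i\<in>UNIV. axis i (g x $ i)) a"
    by (rule lipschitz_near_sum, rule lipschitz_near_linear_compose[OF axis g a])
  also have "(\<lambda>x. \<Sum>i\<in>UNIV. axis i (g x $ i)) = g"
    by (auto simp: vec_eq_iff axis_def fun_eq_iff if_distrib cong: if_cong)
  finally show ?thesis .
qed

lemma lipschitz_near_mult:
  fixes g k :: "'a::metric_space \<Rightarrow> real"
  assumes "lipschitz_near S g a" "lipschitz_near S k a" and a: "a \<in> S"
  shows "lipschitz_near S (\<lambda>x. g x * k x) a"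
proof -
  obtain r L M where r: "r > 0" and L: "L-lipschitz_on (cball a r \<inter> S) g"
      and M: "M-lipschitz_on (cball a r \<inter> S) k"
    using assms(1,2) by (rule lipschitz_nearE2)
  define X where "X = cball a r \<inter> S"
  have L0: "L \<ge> 0" and M0: "M \<ge> 0"
    using L M by (simp_all add: lipschitz_on_nonneg)
  have bound: "\<bar>u x\<bar> \<le> \<bar>u a\<bar> + B * r" if "B-lipschitz_on X u" "x \<in> X" for u :: "'a \<Rightarrow> real" and B x
  proof -
    have "\<bar>u x - u a\<bar> \<le> B * dist x a"
      using lipschitz_onD[OF that(1,2), of a] a r by (simp add: X_def dist_real_def)
    also have "\<dots> \<le> B * r"
    proof (rule mult_left_mono)
      show "dist x a \<le> r"
        using that(2) by (simp add: X_def dist_commute)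
    qed (rule lipschitz_on_nonneg[OF that(1)])
    finally show ?thesis
      by linarith
  qed
  define P Q where "P = \<bar>g a\<bar> + L * r" and "Q = \<bar>k a\<bar> + M * r"
  have "P \<ge> 0" "Q \<ge> 0"
    using L0 M0 r by (auto simp: P_def Q_def)
  have "(P * M + Q * L)-lipschitz_on X (\<lambda>x. g x * k x)"
  proof (rule lipschitz_onI)
    fix x y
    assume x: "x \<in> X" and y: "y \<in> X"
    have eq: "g x * k x - g y * k y = g x * (k x - k y) + k y * (g x - g y)"
      by (simp add: algebra_simps)
    have "\<bar>g x * k x - g y * k y\<bar> \<le> \<bar>g x\<bar> * \<bar>k x - k y\<bar> + \<bar>k y\<bar> * \<bar>g x - g y\<bar>"
      unfolding eq abs_mult[symmetric] by (rule abs_triangle_ineq)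
    also have "\<dots> \<le> P * (M * dist x y) + Q * (L * dist x y)"
    proof (intro add_mono mult_mono)
      show "\<bar>g x\<bar> \<le> P" "\<bar>k y\<bar> \<le> Q"
        using bound[OF L[folded X_def] x] bound[OF M[folded X_def] y] by (simp_all add: P_def Q_def)
      show "\<bar>k x - k y\<bar> \<le> M * dist x y" "\<bar>g x - g y\<bar> \<le> L * dist x y"
        using lipschitz_onD[OF L[folded X_def] x y] lipschitz_onD[OF M[folded X_def] x y]
        by (simp_all add: dist_real_def)
    qed (use \<open>P \<ge> 0\<close> \<open>Q \<ge> 0\<close> in auto)
    finally show "dist (g x * k x) (g y * k y) \<le> (P * M + Q * L) * dist x y"
      by (simp add: dist_real_def algebra_simps)
  qed (use L0 M0 \<open>P \<ge> 0\<close> \<open>Q \<ge> 0\<close> in auto)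
  with r show ?thesis
    unfolding lipschitz_near_def X_def by blast
qed

text \<open>The derivative is bounded near \<open>a\<close> by continuity, and convexity makes the mean value
  inequality available inside \<open>S\<close>, which may have empty interior.\<close>

lemma C1_on_imp_lipschitz_near:
  assumes g: "C1_on S g" and S: "convex S" and a: "a \<in> S"
  shows "lipschitz_near S g a"
proof -
  obtain g' where der: "\<And>x. x \<in> S \<Longrightarrow> (g has_derivative blinfun_apply (g' x)) (at x within S)"
      and cont: "continuous_on S g'"
    using g unfolding C1_on_def by blast
  obtain d where d: "d > 0" "\<And>x. x \<in> S \<Longrightarrow> dist x a < d \<Longrightarrow> dist (g' x) (g' a) < 1"
    using cont a unfolding continuous_on_iff by (metis zero_less_one)
  define X where "X = cball a (d / 2) \<inter> S"
  have bound: "onorm (blinfun_apply (g' x)) \<le> norm (g' a) + 1" if "x \<in> X" for x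
  proof -
    have "dist (g' x) (g' a) < 1"
      using that d(1) by (intro d(2)) (auto simp: X_def dist_commute)
    then have "norm (g' x - g' a) < 1"
      by (simp add: dist_norm)
    then show ?thesis
      using norm_triangle_ineq2[of "g' x" "g' a"] by (simp add: norm_blinfun.rep_eq)
  qed
  have "(norm (g' a) + 1)-lipschitz_on X g"
  proof (rule lipschitz_onI)
    fix x y
    assume "x \<in> X" "y \<in> X"
    then show "dist (g x) (g y) \<le> (norm (g' a) + 1) * dist x y"
      unfolding dist_norm
      by (intro differentiable_bound[where S = X and f' = "\<lambda>x. blinfun_apply (g' x)"] bound
          has_derivative_subset[OF der])
        (auto simp: X_def intro: convex_Int S)
  qed simp
  moreover have "d / 2 > 0"
    using d(1) by simp
  ultimately show ?thesis
    unfolding lipschitz_near_def X_def by blast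
qed

lemma C2_imp_C1_on: "C2 g \<Longrightarrow> C1_on UNIV g"
proof -
  assume "C2 g"
  then obtain g' g'' where
      g': "\<And>x. (g has_derivative blinfun_apply (g' x)) (at x)" and
      g'': "\<And>x. (g' has_derivative blinfun_apply (g'' x)) (at x)"
    unfolding C2_def C1_on_def by auto
  have "continuous_on UNIV g'"
    using g'' has_derivative_continuous by (metis continuous_at_imp_continuous_on)
  with g' show ?thesis
    unfolding C1_on_def by auto
qed

lemma gradient_eqI:
  assumes "GDERIV f x :> D"
  shows "gradient f x = D"
  unfolding gradient_def
proof (rule the_equality)
  show "GDERIV f x :> D"
    by (fact assms)
next
  fix E
  assume "GDERIV f x :> E"
  with assms have "(\<lambda>k. inner k D) = (\<lambda>k. inner k E)"
    unfolding gderiv_def by (rule has_derivative_unique)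
  then show "E = D"
    by (metis inner_commute vector_eq_rdot)
qed

text \<open>Each summand depends on its own block only, so the gradient of the separable cost stacks the
  gradients of the local costs; these are read off from the derivatives on the unit vectors.\<close>

lemma gradient_separable_cost:
  fixes f :: "'n::finite \<Rightarrow> real^'d \<Rightarrow> real"
  assumes f': "\<And>i s. (f i has_derivative blinfun_apply (f' i s)) (at s)"
  shows "gradient (separable_cost f) x = (\<chi> i j. blinfun_apply (f' i (x $ i)) (axis j 1))"
proof (rule gradient_eqI)
  have "(separable_cost f has_derivative (\<lambda>k. \<Sum>i\<in>UNIV. blinfun_apply (f' i (x $ i)) (k $ i))) (at x)"
    unfolding separable_cost_def
  proof (rule has_derivative_sum)
    fix i
    show "((\<lambda>x. f i (x $ i)) has_derivative (\<lambda>k. blinfun_apply (f' i (x $ i)) (k $ i))) (at x)"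
      by (rule has_derivative_compose[OF bounded_linear_imp_has_derivative[OF bounded_linear_vec_nth] f'])
  qed
  also have "(\<lambda>k. \<Sum>i\<in>UNIV. blinfun_apply (f' i (x $ i)) (k $ i))
      = (\<lambda>k. inner k (\<chi> i j. blinfun_apply (f' i (x $ i)) (axis j 1)))"
  proof
    fix k :: "real^'d^'n"
    have "blinfun_apply (f' i (x $ i)) (k $ i)
        = (\<Sum>j\<in>UNIV. k $ i $ j * blinfun_apply (f' i (x $ i)) (axis j 1))" for i
    proof -
      have "blinfun_apply (f' i (x $ i)) (k $ i)
          = blinfun_apply (f' i (x $ i)) (\<Sum>j\<in>UNIV. k $ i $ j *\<^sub>R axis j 1)"
        by (simp add: basis_expansion scalar_mult_eq_scaleR[symmetric])
      then show ?thesis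
        by (simp add: blinfun.sum_right blinfun.scaleR_right)
    qed
    then show "(\<Sum>i\<in>UNIV. blinfun_apply (f' i (x $ i)) (k $ i))
        = inner k (\<chi> i j. blinfun_apply (f' i (x $ i)) (axis j 1))"
      by (simp add: inner_vec_def)
  qed
  finally show "GDERIV (separable_cost f) x :> (\<chi> i j. blinfun_apply (f' i (x $ i)) (axis j 1))"
    by (simp add: gderiv_def)
qed

lemma lipschitz_near_gradient_separable_cost:
  fixes f :: "'n::finite \<Rightarrow> real^'d \<Rightarrow> real"
  assumes "\<And>i. C2 (f i)"
  shows "lipschitz_near UNIV (gradient (separable_cost f)) a"
proof -
  obtain f' where f': "\<And>i s. (f i has_derivative blinfun_apply (f' i s)) (at s)"
      and C1: "\<And>i. C1_on UNIV (f' i)"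
    using assms unfolding C2_def by metis
  have comp: "lipschitz_near UNIV (\<lambda>x::real^'d^'n. f' i (x $ i)) a" for i
    by (rule lipschitz_near_compose[where g = "\<lambda>x. x $ i" and k = "f' i",
          OF lipschitz_near_linear[OF bounded_linear_vec_nth]
            C1_on_imp_lipschitz_near[OF C1 convex_UNIV UNIV_I] UNIV_I UNIV_I])
  have "lipschitz_near UNIV (\<lambda>x. blinfun_apply (f' i (x $ i)) (axis j 1)) a" for i j
    by (rule lipschitz_near_linear_compose[OF blinfun.bounded_linear_left comp UNIV_I])
  then have "lipschitz_near UNIV (\<lambda>x. \<chi> i j. blinfun_apply (f' i (x $ i)) (axis j 1)) a"
    by (intro lipschitz_near_vec UNIV_I) simp
  moreover have "gradient (separable_cost f) = (\<lambda>x. \<chi> i j. blinfun_apply (f' i (x $ i)) (axis j 1))"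
    by (rule ext) (rule gradient_separable_cost[OF f'])
  ultimately show ?thesis
    by simp
qed

lemma lipschitz_near_stack:
  fixes g :: "'n::finite \<Rightarrow> real^'a \<Rightarrow> real^'b"
  assumes "\<And>i. lipschitz_near UNIV (g i) (a $ i)"
  shows "lipschitz_near UNIV (stack g) a"
proof (rule lipschitz_near_vec)
  fix i
  show "lipschitz_near UNIV (\<lambda>x. stack g x $ i) a"
    unfolding stack_def vec_lambda_beta
    by (rule lipschitz_near_compose[where g = "\<lambda>x. x $ i" and k = "g i",
          OF lipschitz_near_linear[OF bounded_linear_vec_nth] assms UNIV_I UNIV_I])
qed simp

text \<open>Every entry is a sum of products of an entry of a Jacobian with an entry of the multiplier.\<close>

lemma lipschitz_near_blkdiag_jacobian_transpose:
  fixes h :: "'n::finite \<Rightarrow> real^'d \<Rightarrow> real^'m"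
  assumes h: "\<And>i. locally_Lipschitz (\<lambda>s. jacobian (h i) (at s))"
    and x: "lipschitz_near S x a" and \<mu>: "lipschitz_near S \<mu> a" and a: "a \<in> S"
  shows "lipschitz_near S (\<lambda>p. blkdiag_jacobian_transpose h (x p) (\<mu> p)) a"
proof (intro lipschitz_near_vec a)
  fix i j
  have xi: "lipschitz_near S (\<lambda>p. x p $ i) a"
    by (rule lipschitz_near_linear_compose[OF bounded_linear_vec_nth x a])
  have J: "lipschitz_near S (\<lambda>p. jacobian (h i) (at (x p $ i))) a"
    by (rule lipschitz_near_compose[where S' = UNIV and g = "\<lambda>p. x p $ i" and
          k = "\<lambda>s. jacobian (h i) (at s)", OF xi locally_Lipschitz_imp_lipschitz_near[OF h] a UNIV_I])
  have Jkj: "lipschitz_near S (\<lambda>p. jacobian (h i) (at (x p $ i)) $ k $ j) a" for k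
    by (rule lipschitz_near_linear_compose[OF bounded_linear_vec_nth
          lipschitz_near_linear_compose[OF bounded_linear_vec_nth J a] a])
  have \<mu>k: "lipschitz_near S (\<lambda>p. \<mu> p $ i $ k) a" for k
    by (rule lipschitz_near_linear_compose[OF bounded_linear_vec_nth
          lipschitz_near_linear_compose[OF bounded_linear_vec_nth \<mu> a] a])
  have "lipschitz_near S (\<lambda>p. \<Sum>k\<in>UNIV. jacobian (h i) (at (x p $ i)) $ k $ j * \<mu> p $ i $ k) a"
    by (intro lipschitz_near_sum lipschitz_near_mult Jkj \<mu>k a)
  then show "lipschitz_near S (\<lambda>p. blkdiag_jacobian_transpose h (x p) (\<mu> p) $ i $ j) a"
    by (simp add: blkdiag_jacobian_transpose_def matrix_vector_mult_def transpose_def)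
qed

section \<open>The network dynamics\<close>

lemma bounded_linear_kron_I: "bounded_linear (kron_I M :: real^'d^'n \<Rightarrow> real^'d^'n)"
proof -
  have "linear (kron_I M :: real^'d^'n \<Rightarrow> real^'d^'n)"
    by (rule linearI)
      (simp_all add: kron_I_def vec_eq_iff scaleR_add_right sum.distrib sum_distrib_left algebra_simps)
  then show ?thesis
    by (simp add: linear_conv_bounded_linear)
qed

text \<open>The diagonal entry cancels the others because the graph has no self-loops.\<close>

lemma laplacian_row_sum:
  assumes "undirected_graph A"
  shows "(\<Sum>j\<in>UNIV. laplacian A $ i $ j) = 0"
proof -
  have "(\<Sum>j\<in>UNIV. laplacian A $ i $ j)
      = (\<Sum>j\<in>UNIV. (if j = i then \<Sum>l\<in>UNIV. A $ i $ l else 0) - A $ i $ j)"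
    using assms by (intro sum.cong) (auto simp: laplacian_def undirected_graph_def)
  then show ?thesis
    by (simp add: sum_subtractf)
qed

lemma lap_ones_kron:
  assumes "undirected_graph A"
  shows "lap A (ones_kron s) = 0"
  using laplacian_row_sum[OF assms]
  by (simp add: kron_I_def ones_kron_def vec_eq_iff sum_distrib_right[symmetric])

lemma subspace_range_lap: "subspace (range (lap A :: real^'d^'n \<Rightarrow> real^'d^'n))"
  by (intro linear_subspace_image bounded_linear.linear bounded_linear_kron_I subspace_UNIV)

lemma subspace_stacked_space: "subspace (stacked_space idx)"
  by (auto simp: subspace_def stacked_space_def block_space_def)

lemma convex_output_space: "convex (output_space A idx)"
  unfolding output_space_def
  by (intro convex_Times subspace_imp_convex subspace_range_lap subspace_stacked_space)

lemma fs_nde_step_eq_euler_step: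
  "fs_nde_step A f h Gg Gh Kpc Kph T = euler_step (sp_field A f h Gg Gh Kpc Kph) T"
  by (auto simp: fun_eq_iff fs_nde_step_def euler_step_def sp_field_def Let_def algebra_simps)

text \<open>The increments of \<open>z\<^sub>c\<close> and \<open>z\<^sub>h\<close> are multiples of the two blocks of the output field at an
  admissible output, hence they lie in the same subspaces as \<open>z\<^sub>c\<close> and \<open>z\<^sub>h\<close>.\<close>

lemma euler_step_sp_field_in_state_space:
  assumes h: "\<And>i s. h i s \<in> block_space (idx i)"
    and G: "output_field Gg Gh \<in> output_space A idx \<rightarrow> output_space A idx"
    and p: "p \<in> state_space A idx"
  shows "euler_step (sp_field A f h Gg Gh Kpc Kph) T p \<in> state_space A idx"
proof -
  obtain x zc zh where p_eq: "p = (x, zc, zh)"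
    by (metis prod_cases3)
  have "(lap A x, stack h x) \<in> output_space A idx"
    using h by (auto simp: output_space_def stacked_space_def stack_def)
  with G have "output_field Gg Gh (lap A x, stack h x) \<in> output_space A idx"
    by (rule funcset_mem)
  then have *: "stack Gg (lap A x) \<in> range (lap A)" "stack Gh (stack h x) \<in> stacked_space idx"
    by (auto simp: output_field_def output_space_def)
  with p show ?thesis
    unfolding p_eq
    by (simp add: state_space_def euler_step_def sp_field_def Let_def 
        subspace_diff subspace_scale subspace_range_lap subspace_stacked_space)
qed

lemma norm_le_state_dist: "norm (p - q) \<le> state_dist p q"
  using norm_Pair_le[of "fst p - fst q" "snd p - snd q"]
  by (simp add: state_dist_def minus_prod_def)

lemma state_dist_le_norm: "state_dist p q \<le> 2 * norm (p - q)"
  using norm_fst_le[of "fst (p - q)" "snd (p - q)"] norm_snd_le[of "snd (p - q)" "fst (p - q)"]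
  by (simp add: state_dist_def minus_prod_def)

text \<open>The output field is known to be \<open>C\<^sup>1\<close> only on the output space, so it has to be composed with the output
  \<open>(L x, h(x))\<close> as a whole, which takes values there; the blocks are extracted afterwards.\<close>

lemma lipschitz_near_sp_field:
  fixes q :: "('d::finite, 'm::finite, 'n::finite) state"
  assumes h_range: "\<And>i s. h i s \<in> block_space (idx i)"
    and G_C1: "C1_on (output_space A idx) (output_field Gg Gh)"
    and f_C2: "\<And>i. C2 (f i)"
    and h_C2: "\<And>i. C2 (h i)"
    and J: "\<And>i. locally_Lipschitz (\<lambda>s. jacobian (h i) (at s))"
    and q: "q \<in> state_space A idx"
  shows "lipschitz_near (state_space A idx) (sp_field A f h Gg Gh Kpc Kph) q"
proof -
  let ?S = "state_space A idx :: ('d, 'm, 'n) state set"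
  let ?y = "\<lambda>p :: ('d, 'm, 'n) state. (lap A (fst p), stack h (fst p))"
  have x: "lipschitz_near ?S fst q"
    by (intro lipschitz_near_linear bounded_linear_fst)
  have z: "lipschitz_near ?S snd q"
    by (intro lipschitz_near_linear bounded_linear_snd)
  have zc: "lipschitz_near ?S (\<lambda>p. fst (snd p)) q" and zh: "lipschitz_near ?S (\<lambda>p. snd (snd p)) q"
    by (rule lipschitz_near_linear_compose[OF bounded_linear_fst z q]
        lipschitz_near_linear_compose[OF bounded_linear_snd z q])+
  have grad: "lipschitz_near ?S (\<lambda>p. gradient (separable_cost f) (fst p)) q"
    by (rule lipschitz_near_compose[OF x lipschitz_near_gradient_separable_cost[OF f_C2] q UNIV_I])
  have lap: "lipschitz_near ?S (\<lambda>p. lap A (fst p)) q"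
    by (rule lipschitz_near_linear_compose[OF bounded_linear_kron_I x q])
  have "lipschitz_near UNIV (stack h) (fst q)"
    by (intro lipschitz_near_stack C1_on_imp_lipschitz_near C2_imp_C1_on h_C2) auto
  then have st: "lipschitz_near ?S (\<lambda>p. stack h (fst p)) q"
    by (rule lipschitz_near_compose[OF x _ q UNIV_I])
  have into: "?y p \<in> output_space A idx" for p
    using h_range by (auto simp: output_space_def stacked_space_def stack_def)
  \<comment> \<open>The output space is a subspace, hence convex, so the \<open>C\<^sup>1\<close> output field is Lipschitz near
    every point of it.\<close>
  have out: "lipschitz_near ?S (\<lambda>p. output_field Gg Gh (?y p)) q"
    by (rule lipschitz_near_compose[where g = ?y and k = "output_field Gg Gh",
          OF lipschitz_near_Pair[OF lap st]
            C1_on_imp_lipschitz_near[OF G_C1 convex_output_space into] q into])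
  have Gg: "lipschitz_near ?S (\<lambda>p. stack Gg (lap A (fst p))) q"
    using lipschitz_near_linear_compose[OF bounded_linear_fst out q] by (simp add: output_field_def)
  have Gh: "lipschitz_near ?S (\<lambda>p. stack Gh (stack h (fst p))) q"
    using lipschitz_near_linear_compose[OF bounded_linear_snd out q] by (simp add: output_field_def)
  have "lipschitz_near ?S (\<lambda>p.
      (- gradient (separable_cost f) (fst p) - (Kpc *\<^sub>R lap A (fst p) + fst (snd p))
         - blkdiag_jacobian_transpose h (fst p) (Kph *\<^sub>R stack h (fst p) + snd (snd p)),
       - (Kpc *\<^sub>R stack Gg (lap A (fst p))),
       - (Kph *\<^sub>R stack Gh (stack h (fst p))))) q"
    by (intro lipschitz_near_Pair lipschitz_near_diff lipschitz_near_minus lipschitz_near_add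
        lipschitz_near_scaleR lipschitz_near_blkdiag_jacobian_transpose[OF J] x zc zh grad lap st Gg Gh q)
  then show ?thesis
    by (simp add: sp_field_def Let_def case_prod_unfold)
qed

text \<open>At a feasible consensus point both outputs vanish, and they are Lipschitz near it, so they
  contribute only a constant factor.\<close>

lemma state_error_le_norm:
  assumes h_C2: "\<And>i. C2 (h i)"
    and lap: "lap A (fst q) = 0" and st: "stack h (fst q) = 0"
  obtains r B where "r > 0" "B \<ge> 0"
    "\<forall>p. norm (p - q) \<le> r \<longrightarrow> state_error A h p q \<le> B * norm (p - q)"
proof -
  have "lipschitz_near UNIV (stack h) (fst q)"
    by (intro lipschitz_near_stack C1_on_imp_lipschitz_near C2_imp_C1_on h_C2) auto
  then obtain r M L where r: "r > 0"
      and M: "M-lipschitz_on (cball (fst q) r \<inter> UNIV) (lap A)"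
      and L: "L-lipschitz_on (cball (fst q) r \<inter> UNIV) (stack h)"
    by (rule lipschitz_nearE2[OF lipschitz_near_linear[OF bounded_linear_kron_I]])
  have M0: "M \<ge> 0" and L0: "L \<ge> 0"
    using M L by (auto dest: lipschitz_on_nonneg)
  have "state_error A h p q \<le> (2 + M + L) * norm (p - q)" if p: "norm (p - q) \<le> r" for p
  proof -
    have x: "norm (fst p - fst q) \<le> norm (p - q)"
      using norm_fst_le[of "fst (p - q)" "snd (p - q)"] by (simp add: minus_prod_def)
    then have "fst p \<in> cball (fst q) r" "fst q \<in> cball (fst q) r"
      using p r by (auto simp: dist_norm norm_minus_commute)
    then have "norm (lap A (fst p)) \<le> M * norm (fst p - fst q)"
        "norm (stack h (fst p)) \<le> L * norm (fst p - fst q)"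
      using lipschitz_on_normD[OF M, of "fst p" "fst q"] lipschitz_on_normD[OF L, of "fst p" "fst q"]
      by (auto simp: lap st)
    then have "norm (lap A (fst p)) \<le> M * norm (p - q)" "norm (stack h (fst p)) \<le> L * norm (p - q)"
      using x M0 L0 by (meson mult_left_mono order_trans)+
    then show ?thesis
      using state_dist_le_norm[of p q] by (simp add: state_error_def algebra_simps)
  qed
  then show ?thesis
    using that[OF r, of "2 + M + L"] M0 L0 by simp
qed

text \<open>Stability in terms of the state error implies stability in the norm of the product space, in
  which the general result is stated; the factor 2 compares the two metrics.\<close>

lemma exp_stable_state_error_imp_norm:
  assumes C: "C > 0" and \<delta>: "\<delta> > 0"
    and stable: "\<forall>p0\<in>S. state_dist p0 q < \<delta> \<longrightarrow>
      (\<exists>p. solves_ode_in S V p \<and> p 0 = p0) \<and>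
      (\<forall>p. solves_ode_in S V p \<and> p 0 = p0 \<longrightarrow>
        (\<forall>t\<ge>0. state_error A h (p t) q \<le> C * exp (- \<alpha> * t) * state_dist p0 q))"
    and p0: "p0 \<in> S" "norm (p0 - q) < \<delta> / 2"
  shows "\<exists>p. solves_ode_in S V p \<and> p 0 = p0 \<and>
    (\<forall>t\<ge>0. norm (p t - q) \<le> 2 * C * exp (- \<alpha> * t) * norm (p0 - q))"
proof -
  have "state_dist p0 q < \<delta>"
    using p0(2) state_dist_le_norm[of p0 q] by linarith
  with stable p0(1) obtain p where p: "solves_ode_in S V p" "p 0 = p0"
      and err: "\<And>t. t \<ge> 0 \<Longrightarrow> state_error A h (p t) q \<le> C * exp (- \<alpha> * t) * state_dist p0 q"
    by blast
  have "norm (p t - q) \<le> 2 * C * exp (- \<alpha> * t) * norm (p0 - q)" if "t \<ge> 0" for t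
  proof -
    have "norm (p t - q) \<le> state_error A h (p t) q"
      unfolding state_error_def
      using norm_le_state_dist[of "p t" q] norm_ge_zero[of "lap A (fst (p t))"]
        norm_ge_zero[of "stack h (fst (p t))"] by linarith
    also have "\<dots> \<le> C * exp (- \<alpha> * t) * state_dist p0 q"
      using that by (rule err)
    also have "\<dots> \<le> C * exp (- \<alpha> * t) * (2 * norm (p0 - q))"
      using C by (intro mult_left_mono state_dist_le_norm) auto
    finally show ?thesis
      by simp
  qed
  with p show ?thesis
    by blast
qed

theorem theorem4:
  fixes A :: "real^'n^'n"
    and idx :: "'n \<Rightarrow> 'm::finite set"
    and f :: "'n \<Rightarrow> real^'d \<Rightarrow> real"
    and h :: "'n \<Rightarrow> real^'d \<Rightarrow> real^'m"
    and Gg :: "'n \<Rightarrow> real^'d \<Rightarrow> real^'d"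
    and Gh :: "'n \<Rightarrow> real^'m \<Rightarrow> real^'m"
    and s_star :: "real^'d"
    and U :: "(real^'d) set"
    and \<rho> \<alpha>\<^sub>G \<alpha>\<^sub>S\<^sub>P \<tau>_star \<tau> K0c K0h :: real
  assumes h_range: "\<And>i s. h i s \<in> block_space (idx i)"
    and G_maps: "output_field Gg Gh \<in> output_space A idx \<rightarrow> output_space A idx"
    and G_C1: "C1_on (output_space A idx) (output_field Gg Gh)"
    and G_zero: "output_field Gg Gh 0 = 0"
    and \<alpha>G_pos: "\<alpha>\<^sub>G > 0"
    and G_stable: "origin_globally_exp_stable (output_space A idx) (output_field Gg Gh) \<alpha>\<^sub>G"
    and gains_pos: "K0c > 0" "K0h > 0"
    and graph: "undirected_graph A" "connected_graph A"
    and f_C2: "\<And>i. C2 (f i)"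
    and h_C2: "\<And>i. C2 (h i)"
    and hessian_Lipschitz: "\<And>i. locally_Lipschitz (\<lambda>s. jacobian (gradient (f i)) (at s))"
    and jacobian_Lipschitz: "\<And>i. locally_Lipschitz (\<lambda>s. jacobian (h i) (at s))"
    and s_star_feasible: "s_star \<in> feasible_set h"
    and U_nbhd: "open U" "s_star \<in> U"
    and \<rho>_pos: "\<rho> > 0"
    and s_star_minimizer: "local_minimizer_on (feasible_set h \<inter> U) (aggregate_cost f) s_star"
    and quadratic_growth: "\<And>s. s \<in> feasible_set h \<inter> U \<Longrightarrow>
        aggregate_cost f s \<ge> aggregate_cost f s_star + \<rho> / 2 * (norm (s - s_star))\<^sup>2"
    and full_rank: "\<And>x. x \<in> stacked_feasible_set h \<inter> ones_kron ` U \<Longrightarrow>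
        rank (col_jacobian h x) = total_dim idx"
    and \<alpha>SP: "0 < \<alpha>\<^sub>S\<^sub>P" "\<alpha>\<^sub>S\<^sub>P < min (\<rho> / real CARD('n)) \<alpha>\<^sub>G"
    and threshold: "is_sp_threshold A idx f h Gg Gh K0c K0h (ones_kron s_star) \<alpha>\<^sub>S\<^sub>P \<tau>_star"
    and \<tau>: "0 < \<tau>" "\<tau> < \<tau>_star"
  shows "\<forall>\<alpha>\<^sub>E. 0 < \<alpha>\<^sub>E \<and> \<alpha>\<^sub>E < \<alpha>\<^sub>S\<^sub>P \<longrightarrow>
    (\<exists>T_star>0. \<forall>T. 0 < T \<and> T < T_star \<longrightarrow>
      (let S = state_space A idx;
           step = fs_nde_step A f h Gg Gh (K0c / \<tau>) (K0h / \<tau>) T;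
           x_star = ones_kron s_star
       in \<exists>z_star. locally_unique_in S (\<lambda>p. step p = p) (x_star, z_star) \<and>
            (\<exists>C>0. \<exists>\<delta>>0. \<forall>p0\<in>S. state_dist p0 (x_star, z_star) < \<delta> \<longrightarrow>
               (\<forall>k::nat. state_error A h ((step ^^ k) p0) (x_star, z_star)
                  \<le> C * exp (- \<alpha>\<^sub>E * real k * T) * state_dist p0 (x_star, z_star)))))"
proof (intro allI impI)
  fix \<alpha>\<^sub>E
  assume \<alpha>E: "0 < \<alpha>\<^sub>E \<and> \<alpha>\<^sub>E < \<alpha>\<^sub>S\<^sub>P"
  let ?S = "state_space A idx :: ('d, 'm, 'n) state set"
  define V where "V = sp_field A f h Gg Gh (K0c / \<tau>) (K0h / \<tau>)"
  obtain z C \<delta> where unique: "locally_unique_in ?S (\<lambda>p. V p = 0) (ones_kron s_star, z)"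
      and C: "C > 0" and \<delta>: "\<delta> > 0"
      and stable: "\<forall>p0\<in>?S. state_dist p0 (ones_kron s_star, z) < \<delta> \<longrightarrow>
        (\<exists>p. solves_ode_in ?S V p \<and> p 0 = p0) \<and>
        (\<forall>p. solves_ode_in ?S V p \<and> p 0 = p0 \<longrightarrow>
          (\<forall>t\<ge>0. state_error A h (p t) (ones_kron s_star, z)
             \<le> C * exp (- \<alpha>\<^sub>S\<^sub>P * t) * state_dist p0 (ones_kron s_star, z)))"
    using threshold \<tau> unfolding is_sp_threshold_def Let_def V_def by blast
  define q where "q = (ones_kron s_star :: real^'d^'n, z)"
  have q: "q \<in> ?S" "V q = 0"
    using unique by (simp_all add: locally_unique_in_def q_def)
  have outputs: "lap A (fst q) = 0" "stack h (fst q) = 0"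
    using lap_ones_kron[OF graph(1)] s_star_feasible
    by (simp_all add: q_def stack_def feasible_set_def ones_kron_def vec_eq_iff)
  have inv: "\<And>p T. p \<in> ?S \<Longrightarrow> euler_step V T p \<in> ?S"
    unfolding V_def using h_range G_maps by (rule euler_step_sp_field_in_state_space)
  have "lipschitz_near ?S V q"
    unfolding V_def using h_range G_C1 f_C2 h_C2 jacobian_Lipschitz q(1)
    by (rule lipschitz_near_sp_field)
  then obtain r L where r: "r > 0" and L: "L-lipschitz_on (cball q r \<inter> ?S) V"
    unfolding lipschitz_near_def by blast
  have rates: "2 * C > 0" "\<delta> / 2 > 0" "0 < \<alpha>\<^sub>E" "\<alpha>\<^sub>E < \<alpha>\<^sub>S\<^sub>P"
    using C \<delta> \<alpha>E by auto
  have flow: "\<exists>y. solves_ode_in ?S V y \<and> y 0 = p \<and>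
      (\<forall>t\<ge>0. norm (y t - q) \<le> 2 * C * exp (- \<alpha>\<^sub>S\<^sub>P * t) * norm (p - q))"
    if "p \<in> ?S" "norm (p - q) < \<delta> / 2" for p
    using C \<delta> stable[folded q_def] that by (rule exp_stable_state_error_imp_norm)
  obtain Ts K \<epsilon> where Ts: "Ts > 0" and K: "K > 0" and \<epsilon>: "\<epsilon> > 0"
      and decay: "\<forall>T p k. 0 < T \<and> T < Ts \<and> p \<in> ?S \<and> norm (p - q) < \<epsilon> \<longrightarrow>
        norm ((euler_step V T ^^ k) p - q) \<le> K * exp (- \<alpha>\<^sub>E * real k * T) * norm (p - q)"
    using L r q inv rates(1,2) flow rates(3,4) by (rule euler_inherits_exp_stability)
  obtain R B where R: "R > 0" and B: "B \<ge> 0"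
      and error: "\<forall>p. norm (p - q) \<le> R \<longrightarrow> state_error A h p q \<le> B * norm (p - q)"
    using h_C2 outputs by (rule state_error_le_norm)
  \<comment> \<open>The radius \<open>R / K\<close> keeps all iterates in the ball where the outputs are controlled by the
    distance to \<open>q\<close>.\<close>
  define \<epsilon>' where "\<epsilon>' = min \<epsilon> (R / K)"
  have \<epsilon>': "\<epsilon>' > 0"
    using \<epsilon> R K by (simp add: \<epsilon>'_def)
  show "\<exists>T_star>0. \<forall>T. 0 < T \<and> T < T_star \<longrightarrow>
      (let S = state_space A idx;
           step = fs_nde_step A f h Gg Gh (K0c / \<tau>) (K0h / \<tau>) T;
           x_star = ones_kron s_star
       in \<exists>z_star. locally_unique_in S (\<lambda>p. step p = p) (x_star, z_star) \<and>
            (\<exists>C>0. \<exists>\<delta>>0. \<forall>p0\<in>S. state_dist p0 (x_star, z_star) < \<delta> \<longrightarrow>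
               (\<forall>k::nat. state_error A h ((step ^^ k) p0) (x_star, z_star)
                  \<le> C * exp (- \<alpha>\<^sub>E * real k * T) * state_dist p0 (x_star, z_star))))"
    unfolding Let_def fs_nde_step_eq_euler_step V_def[symmetric]
  proof (intro exI[of _ Ts] conjI allI impI Ts)
    fix T
    assume T: "0 < T \<and> T < Ts"
    have "(B + 1) * K > 0"
      using B K by simp
    have bound: "state_error A h ((euler_step V T ^^ k) p) q
        \<le> (B + 1) * K * exp (- \<alpha>\<^sub>E * real k * T) * state_dist p q"
      if p: "p \<in> ?S" "state_dist p q < \<epsilon>'" for p k
    proof -
      let ?e = "exp (- \<alpha>\<^sub>E * real k * T)"
      let ?u = "(euler_step V T ^^ k) p"
      have small: "norm (p - q) < \<epsilon>" "norm (p - q) < R / K"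
        using p(2) norm_le_state_dist[of p q] by (auto simp: \<epsilon>'_def)
      have u: "norm (?u - q) \<le> K * ?e * norm (p - q)"
        using decay T p(1) small(1) by blast
      also have "\<dots> \<le> K * 1 * norm (p - q)"
        using T \<alpha>E K by (intro mult_right_mono mult_left_mono) auto
      also have "\<dots> \<le> R"
        using small(2) K by (simp add: field_simps)
      finally have "state_error A h ?u q \<le> B * norm (?u - q)"
        by (rule error[rule_format])
      also have "\<dots> \<le> (B + 1) * (K * ?e * state_dist p q)"
      proof (rule mult_mono)
        show "norm (?u - q) \<le> K * ?e * state_dist p q"
          using u norm_le_state_dist[of p q] K
          by (smt (verit) exp_gt_zero mult_left_mono mult_pos_pos)
      qed (use B in auto)
      finally show ?thesis
        by (simp add: algebra_simps)
    qed
    have fixed: "euler_step V T p = p \<longleftrightarrow> V p = 0" for p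
      using T by (simp add: euler_step_def)
    show "\<exists>z_star. locally_unique_in ?S (\<lambda>p. euler_step V T p = p) (ones_kron s_star, z_star) \<and>
        (\<exists>C>0. \<exists>\<delta>>0. \<forall>p0\<in>?S. state_dist p0 (ones_kron s_star, z_star) < \<delta> \<longrightarrow>
          (\<forall>k. state_error A h ((euler_step V T ^^ k) p0) (ones_kron s_star, z_star)
            \<le> C * exp (- \<alpha>\<^sub>E * real k * T) * state_dist p0 (ones_kron s_star, z_star)))"
    proof (intro exI[of _ z] conjI)
      show "locally_unique_in ?S (\<lambda>p. euler_step V T p = p) (ones_kron s_star, z)"
        using unique by (simp add: fixed)
      show "\<exists>C>0. \<exists>\<delta>>0. \<forall>p0\<in>?S. state_dist p0 (ones_kron s_star, z) < \<delta> \<longrightarrow>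
          (\<forall>k. state_error A h ((euler_step V T ^^ k) p0) (ones_kron s_star, z)
            \<le> C * exp (- \<alpha>\<^sub>E * real k * T) * state_dist p0 (ones_kron s_star, z))"
        using \<open>(B + 1) * K > 0\<close> \<epsilon>' bound[unfolded q_def]
        by (intro exI[of _ "(B + 1) * K"] exI[of _ \<epsilon>'] conjI ballI impI allI)
    qed
  qed
qed

end
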